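(* Let $V$ and $W$ be complex vector spaces of dimensions $n$ and $k$, and let $r$ be a positive integer such that $n$ divides $2r$ and $k$ divides $r$. With the notation of the context, all nontrivial relations among the nonzero elements $S(v_\sigma\otimes w^\eta)$, where $\sigma$ and $\eta$ range through $S_{2r}$ and $S_r$ respectively, are linear combinations of all $$S\Big(v_\sigma\otimes\sum_{\eta_j\in B(\eta,\{i_1,\dots,i_{k+1}\})}(-1)^j w^{\eta_j}\Big)$$ and $$S\Big(\sum_{\sigma_j\in A(\sigma,\{i_1,\dots,i_{n+1}\})}(-1)^{j+1}v_{\sigma_j}\otimes w^\eta\Big)$$ (each expression, set equal to zero, being a relation), for all $\sigma\in S_{2r}$ and $\eta\in S_r$, all possible subsets $\{i_1,\dots,i_{k+1}\}$ of $k+1$ distinct elements of $\{1,\dots,r\}$ in the first family, and all possible subsets $\{i_1,\dots,i_{n+1}\}$ of $n+1$ distinct elements of $\{1,\dots,2r\}$ in the second.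
   Context: $S_m$ is the symmetric group on $\{1,\dots,m\}$ and all vector spaces are over $\mathbf{C}$; the letter $S$ without subscript is the symmetrizing map below. Fix a basis $e_1,\dots,e_n$ of $V$ and a basis $f_1,\dots,f_k$ of $W$ with dual basis $f^1,\dots,f^k$ of $W^*$. Permutation symbols. $\varepsilon^{i_1\dots i_m}$ and $\varepsilon_{i_1\dots i_m}$ equal $1$ (resp. $-1$) if $i_1\dots i_m$ is an even (resp. odd) permutation of $1,\dots,m$, and $0$ otherwise. For $\sigma\in S_{dm}$ put $$\varepsilon^I(m,dm,\sigma)=\prod_{b=0}^{d-1}\varepsilon^{\,i_{\sigma^{-1}(bm+1)}\,i_{\sigma^{-1}(bm+2)}\cdots\, i_{\sigma^{-1}(bm+m)}},$$ and define $\varepsilon_J(m,dm,\sigma)$ in the same way with lower indices $j_1,\dots,j_{dm}$. Invariants. For $\sigma\in S_{2r}$ and $\eta\in S_r$ put (summing over repeated indices) $$v_\sigma=\varepsilon^I(n,2r,\sigma)\,e_{i_1}\otimes\cdots\otimes e_{i_{2r}}\in V^{\otimes 2r},\qquad w^\eta=\varepsilon_J(k,r,\eta)\,f^{j_1}\otimes\cdots\otimes f^{j_r}\in (W^* )^{\otimes r}.$$ Symmetrization. $V^{\otimes 2r}\otimes (W^* )^{\otimes r}$ is identified with $(V\otimes V\otimes W^* )^{\otimes r}$, the $a$-th factor consisting of the $(2a-1)$-th and $2a$-th copies of $V$ and the $a$-th copy of $W^*$. $S:(V\otimes V\otimes W^* )^{\otimes r}\to (V\otimes V\otimes W^* )^{\odot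 r}$ is the symmetrizing map onto symmetric tensors. Some $v_\sigma\otimes w^\eta$ may be sent to zero by $S$. The set $A$. For $\sigma\in S_{2r}$ and any subset $\{i_1,\dots,i_{n+1}\}$ of $n+1$ distinct elements of $\{1,\dots,2r\}$, $A(\sigma,\{i_1,\dots,i_{n+1}\})$ is the set of the $\sigma_j\in S_{2r}$, $1\le j\le n+1$, defined by $\sigma_j(l)=\sigma(l)$ if $l\notin\{i_1,\dots,i_{n+1}\}$, and $\sigma_j(i_l)=\sigma(i_l)$ if $l<j$, $\sigma_j(i_l)=\sigma(i_{l-1})$ if $j<l$, $\sigma_j(i_l)=\sigma(i_{n+1})$ if $j=l$. The set $B$. For $\eta\in S_r$ and any subset $\{i_1,\dots,i_{k+1}\}$ of $k+1$ distinct elements of $\{1,\dots,r\}$, $B(\eta,\{i_1,\dots,i_{k+1}\})$ is the set of the $\eta_j\in S_r$, $1\le j\le k+1$, defined by $\eta_j(l)=\eta(l)$ if $l\notin\{i_1,\dots,i_{k+1}\}$, and $\eta_j(i_l)=\eta(i_l)$ if $l<j$, $\eta_j(i_l)=\eta(i_{l-1})$ if $j<l$, $\eta_j(i_l)=\eta(i_{k+1})$ if $j=l$. "Nontrivial" sets aside the trivial relations, which stem from the fact that rearranging the columns of a determinant changes it by at most a sign. For $W^*$ with $r=kv$: if $\sigma,\tau\in S_r$ satisfy $\{\sigma^{-1}(bk+1),\dots,\sigma^{-1}(bk+k)\}=\{\tau^{-1}(bk+1),\dots,\tau^{-1}(bk+k)\}$ as sets for $b=0,\dots,v-1$, then $w^\sigma=w^\tau$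 if an even number of the $v$ permutations taking the left-hand lists to the right-hand lists are odd, and $w^\sigma=-w^\tau$ if an odd number are. The trivial relations among the $v_\sigma$ are the same with $k,r,w$ replaced by $n,2r,v$.
   Formalization: Not every listed expression is a relation (n=2, k=1, r=2, σ=(2 3), subset {1,2,3} fails), so only those expressions in the two families that do vanish are taken as generators; together with the trivial relations they span all relations. *)

theory Defs
  imports Complex_Main
    "HOL-Library.FuncSet"
    "HOL-Library.Function_Algebras"
    "HOL-Combinatorics.Permutations"
begin

text \<open>
  Complex-valued functions on a set of labels serve two purposes. Tensors are given by their
  coordinates with respect to the bases \<open>e\<^sub>1, \<dots>, e\<^sub>n\<close> of \<open>V\<close> and \<open>f\<^sup>1, \<dots>, f\<^sup>k\<close> of \<open>W\<^sup>*\<close>, so the labels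
  are multi-indices. Formal linear combinations are given by their coefficients, so the labels
  are the formal symbols.
\<close>

definition scl :: "complex \<Rightarrow> ('x \<Rightarrow> complex) \<Rightarrow> 'x \<Rightarrow> complex" where
  "scl a f = (\<lambda>x. a * f x)"

definition unit_fun :: "'x \<Rightarrow> 'x \<Rightarrow> complex" where
  "unit_fun x = (\<lambda>y. if y = x then 1 else 0)"

interpretation cfun: vector_space scl
  by unfold_locales (auto simp: scl_def fun_eq_iff algebra_simps)


subsection \<open>The invariants\<close>

text \<open>\<open>perm_symbol m x\<close> is the permutation symbol with the indices \<open>x 1, \<dots>, x m\<close>.\<close>

definition perm_symbol :: "nat \<Rightarrow> (nat \<Rightarrow> nat) \<Rightarrow> complex" where
  "perm_symbol m x =
     (if bij_betw x {1..m} {1..m}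
      then of_int (sign (\<lambda>l. if l \<in> {1..m} then x l else l)) else 0)"

definition eps_prod :: "nat \<Rightarrow> nat \<Rightarrow> (nat \<Rightarrow> nat) \<Rightarrow> (nat \<Rightarrow> nat) \<Rightarrow> complex" where
  "eps_prod m N \<sigma> I = (\<Prod>b<N div m. perm_symbol m (\<lambda>l. I (inv \<sigma> (b * m + l))))"

definition multi_indices :: "nat \<Rightarrow> nat \<Rightarrow> (nat \<Rightarrow> nat) set" where
  "multi_indices N m = {1..N} \<rightarrow>\<^sub>E {1..m}"

text \<open>
  \<open>det_tensor m N \<sigma>\<close> lies in the \<open>N\<close>-th tensor power of an \<open>m\<close>-dimensional space;
  \<open>unit_fun I\<close> is the basis tensor with multi-index \<open>I\<close>. Thus \<open>v\<^sub>\<sigma>\<close> is \<open>det_tensor n (2 * r) \<sigma>\<close>,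
  and \<open>w\<^sup>\<eta>\<close> is \<open>det_tensor k r \<eta>\<close>.
\<close>

definition det_tensor :: "nat \<Rightarrow> nat \<Rightarrow> (nat \<Rightarrow> nat) \<Rightarrow> (nat \<Rightarrow> nat) \<Rightarrow> complex" where
  "det_tensor m N \<sigma> = (\<Sum>I\<in>multi_indices N m. scl (eps_prod m N \<sigma> I) (unit_fun I))"

definition tensor_prod ::
  "((nat \<Rightarrow> nat) \<Rightarrow> complex) \<Rightarrow> ((nat \<Rightarrow> nat) \<Rightarrow> complex) \<Rightarrow>
   (nat \<Rightarrow> nat) \<times> (nat \<Rightarrow> nat) \<Rightarrow> complex" where
  "tensor_prod x y = (\<lambda>(I, J). x I * y J)"

text \<open>
  The \<open>a\<close>-th factor of \<open>(V \<otimes> V \<otimes> W\<^sup>*)\<^sup>\<otimes>\<^sup>r\<close> consists of the copies \<open>2 * a - 1\<close> and \<open>2 * a\<close> of \<open>V\<close> and of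
  the \<open>a\<close>-th copy of \<open>W\<^sup>*\<close>. A permutation \<open>\<rho>\<close> of the factors permutes the copies of \<open>V\<close> by
  \<open>pair_perm \<rho>\<close>, which sends \<open>2 * a - 1\<close> to \<open>2 * \<rho> a - 1\<close> and \<open>2 * a\<close> to \<open>2 * \<rho> a\<close>.
\<close>

definition pair_perm :: "(nat \<Rightarrow> nat) \<Rightarrow> nat \<Rightarrow> nat" where
  "pair_perm \<rho> p = 2 * \<rho> ((p + 1) div 2) - p mod 2"

definition symmetrize ::
  "nat \<Rightarrow> ((nat \<Rightarrow> nat) \<times> (nat \<Rightarrow> nat) \<Rightarrow> complex) \<Rightarrow>
   (nat \<Rightarrow> nat) \<times> (nat \<Rightarrow> nat) \<Rightarrow> complex" where
  "symmetrize r t =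
     (\<lambda>(I, J). (\<Sum>\<rho> | \<rho> permutes {1..r}. t (I \<circ> pair_perm \<rho>, J \<circ> \<rho>)) / fact r)"

definition perm_pairs :: "nat \<Rightarrow> ((nat \<Rightarrow> nat) \<times> (nat \<Rightarrow> nat)) set" where
  "perm_pairs r = {\<sigma>. \<sigma> permutes {1..2 * r}} \<times> {\<eta>. \<eta> permutes {1..r}}"

text \<open>\<open>S(v\<^sub>\<sigma> \<otimes> w\<^sup>\<eta>)\<close>\<close>

definition sym_elem ::
  "nat \<Rightarrow> nat \<Rightarrow> nat \<Rightarrow> (nat \<Rightarrow> nat) \<times> (nat \<Rightarrow> nat) \<Rightarrow>
   (nat \<Rightarrow> nat) \<times> (nat \<Rightarrow> nat) \<Rightarrow> complex" where
  "sym_elem n k r =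
     (\<lambda>(\<sigma>, \<eta>). symmetrize r (tensor_prod (det_tensor n (2 * r) \<sigma>) (det_tensor k r \<eta>)))"


subsection \<open>Formal linear combinations of the symbols \<open>(\<sigma>, \<eta>)\<close>\<close>

definition formal_value ::
  "nat \<Rightarrow> nat \<Rightarrow> nat \<Rightarrow> ((nat \<Rightarrow> nat) \<times> (nat \<Rightarrow> nat) \<Rightarrow> complex) \<Rightarrow>
   (nat \<Rightarrow> nat) \<times> (nat \<Rightarrow> nat) \<Rightarrow> complex" where
  "formal_value n k r c = (\<Sum>p\<in>perm_pairs r. scl (c p) (sym_elem n k r p))"

text \<open>
  \<open>exchange m \<sigma> i j\<close> is the permutation \<open>\<sigma>\<^sub>j\<close> for the set with elements \<open>i 1, \<dots>, i m\<close>; here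
  \<open>m\<close> will be \<open>n + 1\<close> or \<open>k + 1\<close>.
\<close>

definition exchange ::
  "nat \<Rightarrow> (nat \<Rightarrow> nat) \<Rightarrow> (nat \<Rightarrow> nat) \<Rightarrow> nat \<Rightarrow> nat \<Rightarrow> nat" where
  "exchange m \<sigma> i j x =
     (if x \<in> i ` {1..m} then
        let l = the_inv_into {1..m} i x in
        if l < j then \<sigma> (i l) else if l = j then \<sigma> (i m) else \<sigma> (i (l - 1))
      else \<sigma> x)"

definition exchange_V ::
  "nat \<Rightarrow> nat \<Rightarrow> ((nat \<Rightarrow> nat) \<times> (nat \<Rightarrow> nat) \<Rightarrow> complex) set" where
  "exchange_V n r =
     {\<Sum>j=1..n+1. scl ((-1) ^ (j + 1)) (unit_fun (exchange (n + 1) \<sigma> i j, \<eta>)) | \<sigma> \<eta> i.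
        (\<sigma>, \<eta>) \<in> perm_pairs r \<and> inj_on i {1..n+1} \<and> i ` {1..n+1} \<subseteq> {1..2 * r}}"

definition exchange_W ::
  "nat \<Rightarrow> nat \<Rightarrow> ((nat \<Rightarrow> nat) \<times> (nat \<Rightarrow> nat) \<Rightarrow> complex) set" where
  "exchange_W k r =
     {\<Sum>j=1..k+1. scl ((-1) ^ j) (unit_fun (\<sigma>, exchange (k + 1) \<eta> i j)) | \<sigma> \<eta> i.
        (\<sigma>, \<eta>) \<in> perm_pairs r \<and> inj_on i {1..k+1} \<and> i ` {1..k+1} \<subseteq> {1..r}}"

text \<open>
  The vanishing condition cannot be dropped: for an arbitrary set \<open>{i 1, \<dots>, i (n + 1)}\<close> the
  alternating sum need not be zero. It is zero, for instance, if \<open>\<sigma>\<close> maps \<open>{i 1, \<dots>, i n}\<close> onto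
  one of the blocks \<open>{b * n + 1..b * n + n}\<close>.
\<close>

definition exchange_relations ::
  "nat \<Rightarrow> nat \<Rightarrow> nat \<Rightarrow> ((nat \<Rightarrow> nat) \<times> (nat \<Rightarrow> nat) \<Rightarrow> complex) set" where
  "exchange_relations n k r =
     {g \<in> exchange_V n r \<union> exchange_W k r. formal_value n k r g = 0}"


subsection \<open>Trivial relations\<close>

definition same_blocks :: "nat \<Rightarrow> nat \<Rightarrow> (nat \<Rightarrow> nat) \<Rightarrow> (nat \<Rightarrow> nat) \<Rightarrow> bool" where
  "same_blocks m N \<sigma> \<tau> \<longleftrightarrow>
     (\<forall>b<N div m. inv \<sigma> ` {b * m + 1..b * m + m} = inv \<tau> ` {b * m + 1..b * m + m})"

text \<open>
  \<open>block_perm m \<sigma> \<tau> b\<close> is the permutation taking \<open>inv \<sigma> (b * m + l)\<close> to \<open>inv \<tau> (b * m + l)\<close>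
  for \<open>1 \<le> l \<le> m\<close>.
\<close>

definition block_perm ::
  "nat \<Rightarrow> (nat \<Rightarrow> nat) \<Rightarrow> (nat \<Rightarrow> nat) \<Rightarrow> nat \<Rightarrow> nat \<Rightarrow> nat" where
  "block_perm m \<sigma> \<tau> b x = (if \<sigma> x \<in> {b * m + 1..b * m + m} then inv \<tau> (\<sigma> x) else x)"

definition odd_blocks :: "nat \<Rightarrow> nat \<Rightarrow> (nat \<Rightarrow> nat) \<Rightarrow> (nat \<Rightarrow> nat) \<Rightarrow> nat" where
  "odd_blocks m N \<sigma> \<tau> = card {b. b < N div m \<and> \<not> evenperm (block_perm m \<sigma> \<tau> b)}"

definition trivial_relations ::
  "nat \<Rightarrow> nat \<Rightarrow> nat \<Rightarrow> ((nat \<Rightarrow> nat) \<times> (nat \<Rightarrow> nat) \<Rightarrow> complex) set" where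
  "trivial_relations n k r =
     {unit_fun (\<sigma>, \<eta>) - scl ((-1) ^ odd_blocks n (2 * r) \<sigma> \<tau>) (unit_fun (\<tau>, \<eta>)) | \<sigma> \<tau> \<eta>.
        (\<sigma>, \<eta>) \<in> perm_pairs r \<and> (\<tau>, \<eta>) \<in> perm_pairs r \<and> same_blocks n (2 * r) \<sigma> \<tau>} \<union>
     {unit_fun (\<sigma>, \<eta>) - scl ((-1) ^ odd_blocks k r \<eta> \<theta>) (unit_fun (\<sigma>, \<theta>)) | \<sigma> \<eta> \<theta>.
        (\<sigma>, \<eta>) \<in> perm_pairs r \<and> (\<sigma>, \<theta>) \<in> perm_pairs r \<and> same_blocks k r \<eta> \<theta>}"

text \<open>
  Two symbols that differ only in the order of the \<open>r\<close> factors \<open>V \<otimes> V \<otimes> W\<^sup>*\<close> denote the same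
  symmetric tensor.
\<close>

definition reorderings ::
  "nat \<Rightarrow> ((nat \<Rightarrow> nat) \<times> (nat \<Rightarrow> nat) \<Rightarrow> complex) set" where
  "reorderings r =
     {unit_fun (\<sigma>, \<eta>) - unit_fun (\<sigma> \<circ> pair_perm \<rho>, \<eta> \<circ> \<rho>) | \<sigma> \<eta> \<rho>.
        (\<sigma>, \<eta>) \<in> perm_pairs r \<and> \<rho> permutes {1..r}}"


subsection \<open>Relations among the nonzero elements\<close>

definition nonzero_elems ::
  "nat \<Rightarrow> nat \<Rightarrow> nat \<Rightarrow> ((nat \<Rightarrow> nat) \<times> (nat \<Rightarrow> nat) \<Rightarrow> complex) set" where
  "nonzero_elems n k r = sym_elem n k r ` perm_pairs r - {0}"

text \<open>
  A relation among the nonzero elements: the formal symbols are the elements themselves.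
\<close>

definition elem_relations ::
  "nat \<Rightarrow> nat \<Rightarrow> nat \<Rightarrow> (((nat \<Rightarrow> nat) \<times> (nat \<Rightarrow> nat) \<Rightarrow> complex) \<Rightarrow> complex) set" where
  "elem_relations n k r =
     {c. (\<forall>x. x \<notin> nonzero_elems n k r \<longrightarrow> c x = 0) \<and>
         (\<Sum>x\<in>nonzero_elems n k r. scl (c x) x) = 0}"

text \<open>
  The finer variant in which the formal symbols are the pairs \<open>(\<sigma>, \<eta>)\<close> with
  \<open>S(v\<^sub>\<sigma> \<otimes> w\<^sup>\<eta>) \<noteq> 0\<close>.
\<close>

definition indexed_relations ::
  "nat \<Rightarrow> nat \<Rightarrow> nat \<Rightarrow> ((nat \<Rightarrow> nat) \<times> (nat \<Rightarrow> nat) \<Rightarrow> complex) set" where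
  "indexed_relations n k r =
     {c. (\<forall>p. p \<notin> perm_pairs r \<or> sym_elem n k r p = 0 \<longrightarrow> c p = 0) \<and>
         formal_value n k r c = 0}"

text \<open>
  A formal linear combination of pairs \<open>(\<sigma>, \<eta>)\<close> is read as a combination of nonzero elements
  by dropping the terms that are sent to zero by \<open>S\<close>.
\<close>

definition on_elems ::
  "nat \<Rightarrow> nat \<Rightarrow> nat \<Rightarrow> ((nat \<Rightarrow> nat) \<times> (nat \<Rightarrow> nat) \<Rightarrow> complex) \<Rightarrow>
   ((nat \<Rightarrow> nat) \<times> (nat \<Rightarrow> nat) \<Rightarrow> complex) \<Rightarrow> complex" where
  "on_elems n k r c =
     (\<Sum>p\<in>{p \<in> perm_pairs r. sym_elem n k r p \<noteq> 0}. scl (c p) (unit_fun (sym_elem n k r p)))"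

definition on_nonzero ::
  "nat \<Rightarrow> nat \<Rightarrow> nat \<Rightarrow> ((nat \<Rightarrow> nat) \<times> (nat \<Rightarrow> nat) \<Rightarrow> complex) \<Rightarrow>
   (nat \<Rightarrow> nat) \<times> (nat \<Rightarrow> nat) \<Rightarrow> complex" where
  "on_nonzero n k r c = (\<lambda>p. if sym_elem n k r p = 0 then 0 else c p)"

end

theory Submission
  imports Defs
begin

text \<open>
  Work with formal combinations of the symbols \<open>(\<sigma>, \<eta>)\<close>, and let \<open>G\<close> be the set of trivial
  relations, reorderings and exchange relations. What has to be shown is that a formal combination
  \<open>x\<close> with \<open>formal_value x = 0\<close> lies in the span of \<open>G\<close> (\<open>relation_in_span\<close>); both descriptions of
  the relations among the nonzero elements follow by pushing \<open>x\<close> forward along the linear maps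
  \<open>on_nonzero\<close> and \<open>on_elems\<close>.

  If \<open>x\<close> were not in the span, some linear functional \<open>\<phi>\<close> would vanish on \<open>G\<close> but not on \<open>x\<close>. Put
  \<open>c \<sigma> \<eta> = \<phi> (\<sigma>, \<eta>)\<close>. Vanishing on \<open>G\<close> means that \<open>c\<close> changes by signs under permutations of the
  entries of a block \<open>{b * m + 1..b * m + m}\<close>, is invariant under reorderings of the factors, and
  satisfies the one-box Garnir identity
  \<open>(\<Sum>y in block b. c (transpose z y \<circ> \<sigma>)) = c \<sigma>\<close> for every \<open>z\<close> outside block \<open>b\<close>, in each of its
  two arguments. The point is that such a \<open>c\<close> is a combination of the coordinates of the
  tensors \<open>v\<^sub>\<sigma>\<close>: with \<open>R\<close> the labelling that numbers every block by \<open>1, \<dots>, m\<close>,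
  \<open>H * c \<sigma> = (\<Sum>\<tau>. eps_prod m N \<sigma> (R \<circ> \<tau>) * c \<tau>)\<close> with a positive integer \<open>H\<close>
  (\<open>block_exchange_reconstruction\<close>). Used in both arguments and averaged over the reorderings, this
  writes \<open>\<phi> x\<close> as a combination of coordinates of \<open>formal_value x\<close>, so \<open>\<phi> x = 0\<close>, a contradiction.

  The reconstruction formula is an idempotent-type identity for a rectangular Young diagram, whose
  columns are the blocks. Up to column permutations, which only produce signs, its right-hand side
  is the sum of \<open>c (\<pi> \<circ> \<sigma>)\<close> over all ways to cut the diagram into \<open>m\<close> rows meeting each column once
  and over all \<open>\<pi>\<close> that preserve these rows (\<open>sum_over_block_labellings\<close>). The rows can be removed one
  at a time. Summing over one row adds its columns successively, and in each step the Garnir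
  identity turns the sum over transpositions into a constant factor (\<open>sum_over_transversals\<close>). What
  is left after symmetrizing over a row is a function of the same kind on the remaining rows
  (\<open>exchange_function_symmetrized\<close>), so induction applies.
\<close>

section \<open>Symmetrizing over the rows of a rectangle\<close>

text \<open>
  The columns of the diagram are the fibres of \<open>col\<close> over the points of \<open>B\<close>. The set \<open>X\<close> shrinks
  when rows are removed, which is why columns are not tied to intervals of numbers here.
\<close>

definition exchange_function ::
  "'a set \<Rightarrow> 'b set \<Rightarrow> ('a \<Rightarrow> 'b) \<Rightarrow> (('a \<Rightarrow> 'a) \<Rightarrow> complex) \<Rightarrow> bool" where
  "exchange_function X B col c \<longleftrightarrow>
     (\<forall>s x y. s permutes X \<longrightarrow> x \<in> X \<longrightarrow> y \<in> X \<longrightarrow> x \<noteq> y \<longrightarrow> col x = col y \<longrightarrow>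
        c (transpose x y \<circ> s) = - c s) \<and>
     (\<forall>s z b. s permutes X \<longrightarrow> z \<in> X \<longrightarrow> b \<in> B \<longrightarrow> col z \<noteq> b \<longrightarrow>
        (\<Sum>y | y \<in> X \<and> col y = b. c (transpose z y \<circ> s)) = c s)"

lemma exchange_function_alternating:
  assumes "exchange_function X B col c" "s permutes X" "x \<in> X" "y \<in> X" "x \<noteq> y" "col x = col y"
  shows "c (transpose x y \<circ> s) = - c s"
  using assms unfolding exchange_function_def by blast

lemma exchange_function_sum:
  assumes "exchange_function X B col c" "s permutes X" "z \<in> X" "b \<in> B" "col z \<noteq> b"
  shows "(\<Sum>y | y \<in> X \<and> col y = b. c (transpose z y \<circ> s)) = c s"
  using assms unfolding exchange_function_def by blast

text \<open>
  Let the column \<open>b\<close> be added to those in \<open>A\<close>. A permutation of the enlarged transversal is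
  \<open>transpose y z \<circ> q\<close> with \<open>y\<close> the new point, \<open>q\<close> a permutation of the old transversal, and \<open>z\<close>
  either \<open>y\<close> or an old point. Summing over \<open>y\<close> gives \<open>m\<close> times \<open>c q\<close> in the first case and, by
  the exchange identity for \<open>z\<close> and column \<open>b\<close>, just \<open>c q\<close> for each of the \<open>card A\<close> old points.
\<close>

lemma sum_over_transversals:
  fixes c :: "('a \<Rightarrow> 'a) \<Rightarrow> complex"
  assumes c: "exchange_function X B col c" and X: "finite X" and B: "finite A" "A \<subseteq> B"
    and card: "\<And>b. b \<in> B \<Longrightarrow> card {x \<in> X. col x = b} = m"
  shows "(\<Sum>t\<in>PiE A (\<lambda>b. {x \<in> X. col x = b}). \<Sum>p | p permutes t ` A. c p)
           = of_nat (\<Prod>j<card A. m + j) * c id"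
  using B
proof (induction A rule: finite_induct)
  case empty
  show ?case by simp
next
  case (insert b A)
  let ?C = "\<lambda>b. {x \<in> X. col x = b}"
  have b: "b \<in> B" "A \<subseteq> B" using insert by auto
  have C: "finite (?C b)" for b using X by simp
  have col_t: "t a \<in> X \<and> col (t a) = a" if "t \<in> PiE A ?C" "a \<in> A" for t a
    using that by (auto simp: PiE_iff)
  have "(\<Sum>t\<in>PiE (insert b A) ?C. \<Sum>p | p permutes t ` insert b A. c p)
      = (\<Sum>(y, t)\<in>?C b \<times> PiE A ?C. \<Sum>p | p permutes insert y (t ` A). c p)"
  proof -
    have img: "(t(b := y)) ` insert b A = insert y (t ` A)" for t :: "'b \<Rightarrow> 'a" and y
      using insert.hyps by (auto simp: image_iff)
    show ?thesis
      unfolding PiE_insert_eq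
      by (subst sum.reindex[OF inj_combinator[OF insert.hyps(2)]])
        (simp only: o_def case_prod_unfold img)
  qed
  also have "\<dots> = (\<Sum>t\<in>PiE A ?C. \<Sum>y\<in>?C b. \<Sum>p | p permutes insert y (t ` A). c p)"
    by (subst sum.cartesian_product [symmetric]) (rule sum.swap)
  also have "\<dots> = (\<Sum>t\<in>PiE A ?C. of_nat (m + card A) * (\<Sum>p | p permutes t ` A. c p))"
  proof (rule sum.cong[OF refl])
    fix t assume t: "t \<in> PiE A ?C"
    have inj: "inj_on t A" by (rule inj_onI) (use col_t[OF t] in metis)
    have fin: "finite (t ` A)" using insert.hyps by simp
    have sub: "t ` A \<subseteq> X" using col_t[OF t] by auto
    have notin: "y \<notin> t ` A" if "y \<in> ?C b" for y
      using that col_t[OF t] insert.hyps by auto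
    have "(\<Sum>y\<in>?C b. \<Sum>p | p permutes insert y (t ` A). c p)
        = (\<Sum>y\<in>?C b. \<Sum>z\<in>insert y (t ` A). \<Sum>q | q permutes t ` A. c (transpose y z \<circ> q))"
      using notin by (intro sum.cong refl sum_over_permutations_insert[OF fin]) auto
    also have "\<dots> = (\<Sum>y\<in>?C b. (\<Sum>q | q permutes t ` A. c q) +
                      (\<Sum>z\<in>t ` A. \<Sum>q | q permutes t ` A. c (transpose y z \<circ> q)))"
      by (intro sum.cong refl, subst sum.insert[OF fin notin]) (simp_all add: o_def)
    also have "\<dots> = of_nat m * (\<Sum>q | q permutes t ` A. c q) +
        (\<Sum>z\<in>t ` A. \<Sum>q | q permutes t ` A. \<Sum>y\<in>?C b. c (transpose y z \<circ> q))"
    proof -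
      have "(\<Sum>y\<in>?C b. \<Sum>z\<in>t ` A. \<Sum>q | q permutes t ` A. c (transpose y z \<circ> q))
          = (\<Sum>z\<in>t ` A. \<Sum>y\<in>?C b. \<Sum>q | q permutes t ` A. c (transpose y z \<circ> q))"
        by (rule sum.swap)
      also have "\<dots> = (\<Sum>z\<in>t ` A. \<Sum>q | q permutes t ` A. \<Sum>y\<in>?C b. c (transpose y z \<circ> q))"
        by (intro sum.cong refl sum.swap)
      finally show ?thesis by (simp only: sum.distrib sum_constant card[OF b(1)])
    qed
    also have "(\<Sum>z\<in>t ` A. \<Sum>q | q permutes t ` A. \<Sum>y\<in>?C b. c (transpose y z \<circ> q))
        = (\<Sum>z\<in>t ` A. \<Sum>q | q permutes t ` A. c q)"
    proof (intro sum.cong refl)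
      fix z q assume "z \<in> t ` A" "q \<in> {q. q permutes t ` A}"
      then have "q permutes X" "z \<in> X" "col z \<noteq> b"
        using sub permutes_subset col_t[OF t] insert.hyps by auto
      from exchange_function_sum[OF c this(1,2) b(1) this(3)]
      show "(\<Sum>y\<in>?C b. c (transpose y z \<circ> q)) = c q" by (simp add: transpose_commute)
    qed
    also have "\<dots> = of_nat (card A) * (\<Sum>q | q permutes t ` A. c q)"
      by (simp add: card_image[OF inj])
    finally show "(\<Sum>y\<in>?C b. \<Sum>p | p permutes insert y (t ` A). c p)
        = of_nat (m + card A) * (\<Sum>p | p permutes t ` A. c p)"
      by (simp add: algebra_simps)
  qed
  also have "\<dots> = of_nat (m + card A) * (of_nat (\<Prod>j<card A. m + j) * c id)"
    by (simp only: sum_distrib_left[symmetric] insert.IH[OF b(2)])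
  also have "\<dots> = of_nat (\<Prod>j<card (insert b A). m + j) * c id"
    using insert.hyps by simp
  finally show ?case .
qed

text \<open>
  Transpositions of points outside the row \<open>t ` B\<close> commute with permutations of the row. So the
  only issue is the exchange identity, where the sum over column \<open>b\<close> now misses the row point \<open>t b\<close>.
  The missing term vanishes. With \<open>a\<close> the row point in the column of \<open>z\<close>,
  \<open>(z t\<^sub>b) (a t\<^sub>b) = (a z) (z t\<^sub>b)\<close>: the factor \<open>(a t\<^sub>b)\<close> is absorbed by the sum over the row, and
  \<open>(a z)\<close> contributes a sign because \<open>a\<close> and \<open>z\<close> share a column.
\<close>

lemma exchange_function_symmetrized:
  fixes c :: "('a \<Rightarrow> 'a) \<Rightarrow> complex"
  assumes c: "exchange_function X B col c" and X: "finite X" "col ` X \<subseteq> B"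
    and t: "t \<in> PiE B (\<lambda>b. {x \<in> X. col x = b})"
  shows "exchange_function (X - t ` B) B col (\<lambda>s. \<Sum>p | p permutes t ` B. c (p \<circ> s))"
proof -
  let ?T = "t ` B"
  have col_t: "t b \<in> X \<and> col (t b) = b" if "b \<in> B" for b
    using that t by (auto simp: PiE_iff)
  have T: "?T \<subseteq> X" using col_t by auto
  have perm: "p \<circ> s permutes X" if "p permutes ?T" "s permutes X - ?T" for p s
    by (rule permutes_compose[OF permutes_subset[OF that(2) Diff_subset] permutes_subset[OF that(1) T]])
  have comm: "p \<circ> (transpose x y \<circ> s) = transpose x y \<circ> (p \<circ> s)"
    if "p permutes ?T" "x \<notin> ?T" "y \<notin> ?T" for p x y s
  proof -
    have "p x = x" "p y = y" using that by (auto simp: permutes_def)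
    moreover have "p u = x \<longleftrightarrow> u = x" "p u = y \<longleftrightarrow> u = y" for u
      using calculation permutes_inj[OF that(1)] by (metis injD)+
    ultimately show ?thesis by (auto simp: fun_eq_iff transpose_def)
  qed
  have vanish: "(\<Sum>p | p permutes ?T. c (transpose z (t b) \<circ> (p \<circ> s))) = 0"
    if s: "s permutes X - ?T" and z: "z \<in> X - ?T" and b: "b \<in> B" "col z \<noteq> b" for s z b
  proof -
    let ?a = "t (col z)"
    have "col z \<in> B" using z X(2) by blast
    then have a: "?a \<in> ?T" "?a \<in> X" "col ?a = col z" and tb: "t b \<in> ?T" "col (t b) = b"
      using b col_t by blast+
    have a': "?a \<noteq> z" "?a \<noteq> t b" "z \<noteq> t b"
    proof -
      show "?a \<noteq> z" using a(1) z by (metis DiffD2)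
      show "z \<noteq> t b" using tb(1) z by (metis DiffD2)
      show "?a \<noteq> t b" using a(3) tb(2) b(2) by force
    qed
    have "(\<Sum>p | p permutes ?T. c (transpose z (t b) \<circ> (p \<circ> s)))
        = (\<Sum>p | p permutes ?T. c (transpose z (t b) \<circ> ((transpose ?a (t b) \<circ> p) \<circ> s)))"
      by (rule setum_permutations_compose_left) (rule permutes_swap_id[OF a(1) tb(1)])
    also have "\<dots> = (\<Sum>p | p permutes ?T. - c (transpose z (t b) \<circ> (p \<circ> s)))"
    proof (intro sum.cong refl)
      fix p assume p: "p \<in> {p. p permutes ?T}"
      have "transpose z (t b) \<circ> ((transpose ?a (t b) \<circ> p) \<circ> s)
          = transpose ?a z \<circ> (transpose z (t b) \<circ> (p \<circ> s))"
        using a' by (simp add: fun_eq_iff transpose_def)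
      moreover have "transpose z (t b) \<circ> (p \<circ> s) permutes X"
        using p perm[OF _ s] z tb T by (intro permutes_compose[OF _ permutes_swap_id]) auto
      ultimately show "c (transpose z (t b) \<circ> ((transpose ?a (t b) \<circ> p) \<circ> s))
          = - c (transpose z (t b) \<circ> (p \<circ> s))"
        using exchange_function_alternating[OF c _ a(2) _ a'(1) a(3)] z by auto
    qed
    finally show ?thesis by (simp add: sum_negf)
  qed
  show ?thesis
    unfolding exchange_function_def
  proof (intro conjI allI impI)
    fix s x y assume s: "s permutes X - ?T" and xy: "x \<in> X - ?T" "y \<in> X - ?T" "x \<noteq> y" "col x = col y"
    have "(\<Sum>p | p permutes ?T. c (p \<circ> (transpose x y \<circ> s))) = (\<Sum>p | p permutes ?T. - c (p \<circ> s))"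
    proof (intro sum.cong refl)
      fix p assume "p \<in> {p. p permutes ?T}"
      then show "c (p \<circ> (transpose x y \<circ> s)) = - c (p \<circ> s)"
        using xy exchange_function_alternating[OF c perm[OF _ s], of p x y] by (simp add: comm)
    qed
    then show "(\<Sum>p | p permutes ?T. c (p \<circ> (transpose x y \<circ> s))) = - (\<Sum>p | p permutes ?T. c (p \<circ> s))"
      by (simp add: sum_negf)
  next
    fix s z b assume s: "s permutes X - ?T" and z: "z \<in> X - ?T" and b: "b \<in> B" "col z \<noteq> b"
    let ?C = "{y. y \<in> X - ?T \<and> col y = b}"
    have C: "{y. y \<in> X \<and> col y = b} = insert (t b) ?C" "t b \<notin> ?C" "finite ?C"
      using col_t b X by auto
    have "(\<Sum>y\<in>?C. \<Sum>p | p permutes ?T. c (p \<circ> (transpose z y \<circ> s)))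
        = (\<Sum>y\<in>?C. \<Sum>p | p permutes ?T. c (transpose z y \<circ> (p \<circ> s)))"
      using z by (intro sum.cong refl arg_cong[of _ _ c] comm) auto
    also have "\<dots> = (\<Sum>p | p permutes ?T. \<Sum>y\<in>?C. c (transpose z y \<circ> (p \<circ> s)))"
      by (rule sum.swap)
    also have "\<dots> = (\<Sum>p | p permutes ?T. c (transpose z (t b) \<circ> (p \<circ> s)) +
                                        (\<Sum>y\<in>?C. c (transpose z y \<circ> (p \<circ> s))))"
      by (simp only: sum.distrib vanish[OF s z b]) simp
    also have "\<dots> = (\<Sum>p | p permutes ?T. c (p \<circ> s))"
    proof (intro sum.cong refl)
      fix p assume "p \<in> {p. p permutes ?T}"
      then show "c (transpose z (t b) \<circ> (p \<circ> s)) + (\<Sum>y\<in>?C. c (transpose z y \<circ> (p \<circ> s))) = c (p \<circ> s)"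
        using exchange_function_sum[OF c perm[OF _ s, of p], of z b] z b C by simp
    qed
    finally show "(\<Sum>y\<in>?C. \<Sum>p | p permutes ?T. c (p \<circ> (transpose z y \<circ> s)))
        = (\<Sum>p | p permutes ?T. c (p \<circ> s))" .
  qed
qed

section \<open>Summation over all ways to cut into rows\<close>

text \<open>
  A cut of the diagram into \<open>m\<close> rows is encoded by the number of the row of each point.
\<close>

definition block_labellings ::
  "nat \<Rightarrow> 'a set \<Rightarrow> 'b set \<Rightarrow> ('a \<Rightarrow> 'b) \<Rightarrow> ('a \<Rightarrow> nat) set" where
  "block_labellings m X B col =
     {R \<in> X \<rightarrow>\<^sub>E {1..m}. \<forall>b\<in>B. bij_betw R {x \<in> X. col x = b} {1..m}}"

lemma transversal_fibre:
  assumes "t \<in> PiE B (\<lambda>b. {x \<in> X. col x = b})" "b \<in> B"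
  shows "{x \<in> X - t ` B. col x = b} = {x \<in> X. col x = b} - {t b}" "t b \<in> X" "col (t b) = b"
  using assms by (auto simp: PiE_iff)

text \<open>
  The points with the largest label form a transversal, and the other labels form a cut of the
  rest into one row fewer.
\<close>

lemma bij_betw_block_labellings_Suc:
  assumes "col ` X \<subseteq> B"
  shows "bij_betw (\<lambda>(t, R). \<lambda>x\<in>X. if x \<in> t ` B then Suc m else R x)
           (SIGMA t:PiE B (\<lambda>b. {x \<in> X. col x = b}). block_labellings m (X - t ` B) B col)
           (block_labellings (Suc m) X B col)"
proof -
  let ?C = "\<lambda>b. {x \<in> X. col x = b}"
  let ?f = "\<lambda>(t, R). \<lambda>x\<in>X. if x \<in> t ` B then Suc m else R x"
  let ?t = "\<lambda>R. \<lambda>b\<in>B. inv_into (?C b) R (Suc m)"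
  let ?g = "\<lambda>R. (?t R, restrict R (X - ?t R ` B))"
  have t: "?t R \<in> PiE B ?C \<and> (\<forall>b\<in>B. R (?t R b) = Suc m) \<and> ?t R ` B = {x \<in> X. R x = Suc m}"
    if R: "R \<in> block_labellings (Suc m) X B col" for R
  proof -
    have bij: "bij_betw R (?C b) {1..Suc m}" if "b \<in> B" for b
      using R that by (auto simp: block_labellings_def)
    then have img: "Suc m \<in> R ` ?C b" if "b \<in> B" for b
      using that by (simp add: bij_betw_def)
    have mem: "?t R b \<in> ?C b" "R (?t R b) = Suc m" if "b \<in> B" for b
      using inv_into_into[OF img[OF that]] f_inv_into_f[OF img[OF that]] that by auto
    have "x \<in> ?t R ` B" if x: "x \<in> X" "R x = Suc m" for x
    proof
      show b: "col x \<in> B" using x assms by auto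
      show "x = ?t R (col x)"
        by (rule inj_onD[OF bij_betw_imp_inj_on[OF bij[OF b]]])
          (use x mem[OF b] in auto)
    qed
    moreover have "?t R ` B \<subseteq> {x \<in> X. R x = Suc m}" using mem by auto
    moreover have "?t R \<in> PiE B ?C" using mem by (auto simp: PiE_iff)
    ultimately show ?thesis using mem by blast
  qed
  show ?thesis
  proof (rule bij_betw_byWitness[where f' = ?g])
    show "\<forall>a\<in>SIGMA t:PiE B ?C. block_labellings m (X - t ` B) B col. ?g (?f a) = a"
    proof
      fix a assume "a \<in> (SIGMA t:PiE B ?C. block_labellings m (X - t ` B) B col)"
      then obtain u R where a: "a = (u, R)"
        and u: "u \<in> PiE B ?C" and R: "R \<in> block_labellings m (X - u ` B) B col" by auto
      let ?F = "\<lambda>x\<in>X. if x \<in> u ` B then Suc m else R x"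
      have Rle: "R x \<noteq> Suc m" if "x \<in> X" "x \<notin> u ` B" for x
        using R that PiE_mem[of R "X - u ` B" "\<lambda>_. {1..m}" x] by (auto simp: block_labellings_def)
      have tu: "?t ?F = u"
      proof
        fix b
        show "?t ?F b = u b"
        proof (cases "b \<in> B")
          case True
          have *: "u b \<in> ?C b" "u b \<in> u ` B" using u True by auto
          have "Suc m \<in> ?F ` ?C b" using * by (force simp: image_iff)
          from inv_into_into[OF this] f_inv_into_f[OF this]
          obtain y where y: "inv_into (?C b) ?F (Suc m) = y" "y \<in> X" "col y = b" "y \<in> u ` B"
            using Rle by (auto split: if_splits)
          then have "y = u b" using u by (auto simp: PiE_iff)
          then show ?thesis using True y(1) by simp
        next
          case False then show ?thesis using u by (auto simp: PiE_iff extensional_def)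
        qed
      qed
      have "restrict ?F (X - u ` B) = R"
        using R by (fastforce simp: block_labellings_def PiE_iff extensional_def fun_eq_iff)
      then show "?g (?f a) = a" unfolding a prod.case tu by (simp only:)
    qed
    show "\<forall>R\<in>block_labellings (Suc m) X B col. ?f (?g R) = R"
    proof
      fix R assume R: "R \<in> block_labellings (Suc m) X B col"
      then have "x \<notin> X \<Longrightarrow> R x = undefined" for x
        by (auto simp: block_labellings_def PiE_iff extensional_def)
      then show "?f (?g R) = R" using t[OF R] by (auto simp: fun_eq_iff restrict_def)
    qed
    show "?f ` (SIGMA t:PiE B ?C. block_labellings m (X - t ` B) B col)
            \<subseteq> block_labellings (Suc m) X B col"
    proof (rule image_subsetI)
      fix a assume "a \<in> (SIGMA t:PiE B ?C. block_labellings m (X - t ` B) B col)"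
      then obtain u R where a: "a = (u, R)"
        and u: "u \<in> PiE B ?C" and R: "R \<in> block_labellings m (X - u ` B) B col" by auto
      let ?F = "\<lambda>x\<in>X. if x \<in> u ` B then Suc m else R x"
      have "?F \<in> X \<rightarrow>\<^sub>E {1..Suc m}"
        using R by (force simp: block_labellings_def PiE_iff)
      moreover have "bij_betw ?F (?C b) {1..Suc m}" if b: "b \<in> B" for b
      proof -
        note f = transversal_fibre[OF u b]
        have "bij_betw R (?C b - {u b}) {1..m}"
          using R b unfolding f(1)[symmetric] block_labellings_def by blast
        moreover have "?F x = R x" if "x \<in> ?C b - {u b}" for x
          using that f(1) by auto
        ultimately have "bij_betw ?F (?C b - {u b}) {1..m}"
          by (subst bij_betw_cong) auto
        moreover have "?F (u b) = Suc m" using f b by auto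
        ultimately have "bij_betw ?F ((?C b - {u b}) \<union> {u b}) ({1..m} \<union> {Suc m})"
          using notIn_Un_bij_betw[of "u b" "?C b - {u b}" ?F "{1..m}"]
          by (simp del: restrict_apply)
        moreover have "(?C b - {u b}) \<union> {u b} = ?C b" using f(2,3) by blast
        moreover have "{1..m} \<union> {Suc m} = {1..Suc m}" by auto
        ultimately show ?thesis by simp
      qed
      ultimately show "?f a \<in> block_labellings (Suc m) X B col"
        unfolding a prod.case block_labellings_def by blast
    qed
    show "?g ` block_labellings (Suc m) X B col
            \<subseteq> (SIGMA t:PiE B ?C. block_labellings m (X - t ` B) B col)"
    proof (rule image_subsetI)
      fix R assume R: "R \<in> block_labellings (Suc m) X B col"
      note tR = t[OF R]
      have "restrict R (X - ?t R ` B) \<in> (X - ?t R ` B) \<rightarrow>\<^sub>E {1..m}"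
        unfolding tR[THEN conjunct2, THEN conjunct2] restrict_PiE_iff
      proof
        fix x assume x: "x \<in> X - {x \<in> X. R x = Suc m}"
        then have "R x \<in> {1..Suc m}"
          using R PiE_mem[of R X "\<lambda>_. {1..Suc m}" x] by (auto simp: block_labellings_def)
        then show "R x \<in> {1..m}" using x by auto
      qed
      moreover have "bij_betw (restrict R (X - ?t R ` B)) {x \<in> X - ?t R ` B. col x = b} {1..m}"
        if b: "b \<in> B" for b
      proof -
        note f = transversal_fibre[OF conjunct1[OF tR] b]
        have "bij_betw R (?C b - {?t R b}) ({1..Suc m} - {Suc m})"
          by (rule bij_betw_DiffI) (use R b f tR in \<open>auto simp: block_labellings_def\<close>)
        then have "bij_betw R {x \<in> X - ?t R ` B. col x = b} {1..m}"
          unfolding f(1) by (simp add: atLeastAtMostSuc_conv)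
        then show ?thesis by (subst bij_betw_cong[where g = R]) auto
      qed
      ultimately have "restrict R (X - ?t R ` B) \<in> block_labellings m (X - ?t R ` B) B col"
        unfolding block_labellings_def by blast
      then show "?g R \<in> (SIGMA t:PiE B ?C. block_labellings m (X - t ` B) B col)"
        using tR by blast
    qed
  qed
qed

text \<open>
  A permutation that preserves the labels preserves the set \<open>T\<close> of points with label \<open>a\<close>, so it
  is a permutation of \<open>T\<close> composed with a label-preserving one of the complement.
\<close>

lemma sum_over_stabilizer_split:
  fixes c :: "('a \<Rightarrow> 'a) \<Rightarrow> complex"
  assumes X: "finite X" and T: "T \<subseteq> X"
    and F: "\<And>x. x \<in> X \<Longrightarrow> F x = (if x \<in> T then a else R x)"
    and R: "\<And>x. x \<in> X - T \<Longrightarrow> R x \<noteq> a"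
  shows "(\<Sum>s | s permutes X \<and> (\<forall>x\<in>X. F (s x) = F x). c s)
       = (\<Sum>q | q permutes X - T \<and> (\<forall>x\<in>X - T. R (q x) = R x). \<Sum>p | p permutes T. c (p \<circ> q))"
proof -
  let ?P = "{p. p permutes T}" and ?Q = "{q. q permutes X - T \<and> (\<forall>x\<in>X - T. R (q x) = R x)}"
  have pres: "s x \<in> T \<longleftrightarrow> x \<in> T" "s x \<in> X"
    if s: "s permutes X" "\<forall>x\<in>X. F (s x) = F x" and x: "x \<in> X" for s x
  proof -
    show sx: "s x \<in> X" using permutes_in_image[OF s(1)] x by simp
    have "F (s x) = F x" using s(2) x by blast
    then show "s x \<in> T \<longleftrightarrow> x \<in> T"
      using F[OF x] F[OF sx] R[of x] R[of "s x"] x sx by (auto split: if_splits)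
  qed
  have perm: "(\<lambda>x. if x \<in> Y then s x else x) permutes Y"
    if s: "s permutes X" and Y: "Y \<subseteq> X" "\<And>x. x \<in> Y \<Longrightarrow> s x \<in> Y" for s Y
  proof (rule bij_imp_permutes)
    have inj: "inj_on s Y" using permutes_inj[OF s] inj_on_subset by blast
    have "s ` Y = Y" using Y inj finite_subset[OF Y(1) X] endo_inj_surj[of Y s] by blast
    with inj have "bij_betw s Y Y" by (simp add: bij_betw_def)
    then show "bij_betw (\<lambda>x. if x \<in> Y then s x else x) Y Y" by (subst bij_betw_cong[where g = s]) auto
  qed simp
  have "(\<Sum>s | s permutes X \<and> (\<forall>x\<in>X. F (s x) = F x). c s) = (\<Sum>(q, p)\<in>?Q \<times> ?P. c (p \<circ> q))"
  proof (rule sum.reindex_bij_witness[where i = "\<lambda>(q, p). p \<circ> q" and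
        j = "\<lambda>s. (\<lambda>x. if x \<in> X - T then s x else x, \<lambda>x. if x \<in> T then s x else x)"])
    fix s assume "s \<in> {s. s permutes X \<and> (\<forall>x\<in>X. F (s x) = F x)}"
    then have s: "s permutes X" "\<forall>x\<in>X. F (s x) = F x" by auto
    have out: "x \<notin> X \<Longrightarrow> s x = x" for x using s(1) by (auto simp: permutes_def)
    have comp: "(\<lambda>x. if x \<in> T then s x else x) \<circ> (\<lambda>x. if x \<in> X - T then s x else x) = s"
      using pres[OF s] out by (auto simp: fun_eq_iff)
    then show "(case (\<lambda>x. if x \<in> X - T then s x else x, \<lambda>x. if x \<in> T then s x else x) of
        (q, p) \<Rightarrow> p \<circ> q) = s" by simp
    show "(case (\<lambda>x. if x \<in> X - T then s x else x, \<lambda>x. if x \<in> T then s x else x) of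
        (q, p) \<Rightarrow> c (p \<circ> q)) = c s" using comp by simp
    have "R (s x) = R x" if "x \<in> X - T" for x
      using s(2) pres[OF s, of x] F[of x] F[of "s x"] that by auto
    then show "(\<lambda>x. if x \<in> X - T then s x else x, \<lambda>x. if x \<in> T then s x else x) \<in> ?Q \<times> ?P"
      using perm[OF s(1), of T] perm[OF s(1), of "X - T"] pres[OF s] T by auto
  next
    fix pq assume "pq \<in> ?Q \<times> ?P"
    then obtain q p where pq: "pq = (q, p)" and q: "q permutes X - T" "\<forall>x\<in>X - T. R (q x) = R x"
      and p: "p permutes T" by auto
    have q1: "q x = x" if "x \<notin> X - T" for x using q(1) that by (auto simp: permutes_def)
    have q2: "q x \<in> X - T" if "x \<in> X - T" for x using permutes_in_image[OF q(1)] that by blast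
    have p1: "p x = x" if "x \<notin> T" for x using p that by (auto simp: permutes_def)
    have p2: "p x \<in> T" if "x \<in> T" for x using permutes_in_image[OF p] that by blast
    have "(\<lambda>x. if x \<in> X - T then (p \<circ> q) x else x) = q"
      using q1 q2 p1 by (auto simp: fun_eq_iff)
    moreover have "(\<lambda>x. if x \<in> T then (p \<circ> q) x else x) = p"
      using q1 p1 by (auto simp: fun_eq_iff)
    ultimately show "(\<lambda>x. if x \<in> X - T then (case pq of (q, p) \<Rightarrow> p \<circ> q) x else x,
       \<lambda>x. if x \<in> T then (case pq of (q, p) \<Rightarrow> p \<circ> q) x else x) = pq"
      unfolding pq by (simp only: prod.case)
    have "F (p (q x)) = F x" if "x \<in> X" for x
    proof (cases "x \<in> T")
      case True
      then have "p x \<in> X" "q x = x" using p2 q1 T by auto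
      then show ?thesis using True p2[of x] that F[of "p x"] F[of x] by simp
    next
      case False
      then show ?thesis using q2[of x] p1[of "q x"] that F[of "q x"] F[of x] q(2) by auto
    qed
    moreover have "p \<circ> q permutes X"
      by (rule permutes_compose[OF permutes_subset[OF q(1)] permutes_subset[OF p T]]) auto
    ultimately show "(case pq of (q, p) \<Rightarrow> p \<circ> q) \<in> {s. s permutes X \<and> (\<forall>x\<in>X. F (s x) = F x)}"
      unfolding pq by simp
  qed
  also have "\<dots> = (\<Sum>q\<in>?Q. \<Sum>p\<in>?P. c (p \<circ> q))" by (rule sum.cartesian_product[symmetric])
  finally show ?thesis .
qed

text \<open>
  Removing the row with the largest label leaves the same sum for the function that is symmetrized
  over this row. Only the value of that function at \<open>id\<close> survives, and \<open>sum_over_transversals\<close>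
  evaluates it.
\<close>

lemma sum_over_block_labellings:
  fixes c :: "('a \<Rightarrow> 'a) \<Rightarrow> complex"
  assumes "exchange_function X B col c" "finite X" "finite B" "col ` X \<subseteq> B"
    and "\<And>b. b \<in> B \<Longrightarrow> card {x \<in> X. col x = b} = m"
  shows "(\<Sum>R\<in>block_labellings m X B col. \<Sum>p | p permutes X \<and> (\<forall>x\<in>X. R (p x) = R x). c p)
           = of_nat (\<Prod>i=1..m. \<Prod>j<card B. i + j) * c id"
  using assms
proof (induction m arbitrary: X c)
  case 0
  have "x \<notin> X" for x
  proof
    assume x: "x \<in> X"
    then have "card {y \<in> X. col y = col x} = 0" using 0 by auto
    with x 0(2) show False by auto
  qed
  then have X: "X = {}" by blast
  have "block_labellings 0 X B col = {\<lambda>_. undefined}"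
    unfolding X by (auto simp: block_labellings_def bij_betw_def)
  then show ?case by (simp add: X id_def)
next
  case (Suc m)
  let ?C = "\<lambda>b. {x \<in> X. col x = b}"
  let ?F = "\<lambda>(t, R). \<lambda>x\<in>X. if x \<in> t ` B then Suc m else R x"
  let ?H = "of_nat (\<Prod>i=1..m. \<Prod>j<card B. i + j) :: complex"
  have finL: "finite (block_labellings m Y B col)" if "finite Y" for Y :: "'a set"
    by (rule finite_subset[of _ "Y \<rightarrow>\<^sub>E {1..m}"]) (auto simp: block_labellings_def that intro: finite_PiE)
  have finP: "finite (PiE B ?C)" using Suc.prems by (intro finite_PiE) auto
  have "(\<Sum>R\<in>block_labellings (Suc m) X B col. \<Sum>p | p permutes X \<and> (\<forall>x\<in>X. R (p x) = R x). c p)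
      = (\<Sum>tR\<in>(SIGMA t:PiE B ?C. block_labellings m (X - t ` B) B col).
           \<Sum>p | p permutes X \<and> (\<forall>x\<in>X. ?F tR (p x) = ?F tR x). c p)"
    by (rule sum.reindex_bij_betw[symmetric, OF bij_betw_block_labellings_Suc[OF Suc.prems(4)]])
  also have "\<dots> = (\<Sum>t\<in>PiE B ?C. \<Sum>R\<in>block_labellings m (X - t ` B) B col.
           \<Sum>p | p permutes X \<and> (\<forall>x\<in>X. ?F (t, R) (p x) = ?F (t, R) x). c p)"
    by (subst sum.Sigma) (use finL finP Suc.prems(2) in \<open>auto simp: case_prod_unfold\<close>)
  also have "\<dots> = (\<Sum>t\<in>PiE B ?C. ?H * (\<Sum>p | p permutes t ` B. c p))"
  proof (rule sum.cong[OF refl])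
    fix t assume t: "t \<in> PiE B ?C"
    have sub: "t ` B \<subseteq> X" using t by (auto simp: PiE_iff)
    have "(\<Sum>R\<in>block_labellings m (X - t ` B) B col.
           \<Sum>p | p permutes X \<and> (\<forall>x\<in>X. ?F (t, R) (p x) = ?F (t, R) x). c p)
        = (\<Sum>R\<in>block_labellings m (X - t ` B) B col.
           \<Sum>q | q permutes X - t ` B \<and> (\<forall>x\<in>X - t ` B. R (q x) = R x). \<Sum>p | p permutes t ` B. c (p \<circ> q))"
    proof (rule sum.cong[OF refl])
      fix R assume "R \<in> block_labellings m (X - t ` B) B col"
      then have R: "R x \<noteq> Suc m" if "x \<in> X - t ` B" for x
        using that PiE_mem[of R "X - t ` B" "\<lambda>_. {1..m}" x] by (auto simp: block_labellings_def)
      show "(\<Sum>p | p permutes X \<and> (\<forall>x\<in>X. ?F (t, R) (p x) = ?F (t, R) x). c p)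
        = (\<Sum>q | q permutes X - t ` B \<and> (\<forall>x\<in>X - t ` B. R (q x) = R x). \<Sum>p | p permutes t ` B. c (p \<circ> q))"
        by (rule sum_over_stabilizer_split[where a = "Suc m", OF Suc.prems(2) sub _ R]) auto
    qed
    also have "\<dots> = ?H * (\<Sum>p | p permutes t ` B. c (p \<circ> id))"
    proof (rule Suc.IH)
      show "exchange_function (X - t ` B) B col (\<lambda>q. \<Sum>p | p permutes t ` B. c (p \<circ> q))"
        by (rule exchange_function_symmetrized) (use Suc.prems t in auto)
      fix b assume b: "b \<in> B"
      show "card {x \<in> X - t ` B. col x = b} = m"
        unfolding transversal_fibre(1)[OF t b]
        using transversal_fibre(2,3)[OF t b] Suc.prems(2) Suc.prems(5)[OF b] by simp
    qed (use Suc.prems in auto)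
    finally show "(\<Sum>R\<in>block_labellings m (X - t ` B) B col.
           \<Sum>p | p permutes X \<and> (\<forall>x\<in>X. ?F (t, R) (p x) = ?F (t, R) x). c p)
        = ?H * (\<Sum>p | p permutes t ` B. c p)" by simp
  qed
  also have "\<dots> = ?H * (of_nat (\<Prod>j<card B. Suc m + j) * c id)"
    by (simp only: sum_distrib_left[symmetric]
        sum_over_transversals[OF Suc.prems(1,2,3) order_refl Suc.prems(5)])
  also have "\<dots> = of_nat (\<Prod>i=1..Suc m. \<Prod>j<card B. i + j) * c id"
    by (simp add: atLeastAtMostSuc_conv mult_ac)
  finally show ?case .
qed

section \<open>Blocks of consecutive numbers and permutation symbols\<close>

lemma mem_block_iff:
  fixes m b x :: nat
  assumes "m > 0"
  shows "x \<in> {b * m + 1..b * m + m} \<longleftrightarrow> 1 \<le> x \<and> (x - 1) div m = b"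
proof (cases x)
  case (Suc y)
  have "b * m \<le> y \<and> y < b * m + m \<longleftrightarrow> y div m = b"
  proof
    assume "b * m \<le> y \<and> y < b * m + m"
    then show "y div m = b" by (intro div_nat_eqI) (auto simp: mult.commute)
  next
    assume "y div m = b"
    then show "b * m \<le> y \<and> y < b * m + m"
      using div_times_less_eq_dividend[of y m] dividend_less_div_times[OF assms, of y] by auto
  qed
  moreover have "x \<in> {b * m + 1..b * m + m} \<longleftrightarrow> b * m \<le> y \<and> y < b * m + m"
    using Suc by auto
  ultimately show ?thesis using Suc by simp
qed simp

lemma block_subset:
  fixes m N b :: nat
  assumes "m dvd N" "b < N div m"
  shows "{b * m + 1..b * m + m} \<subseteq> {1..N}"
proof -
  have "(b + 1) * m \<le> N div m * m" using assms by (intro mult_le_mono1) simp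
  then show ?thesis using assms by auto
qed

lemma block_index_less:
  fixes m N x :: nat
  assumes "m > 0" "m dvd N" "x \<in> {1..N}"
  shows "(x - 1) div m < N div m"
proof -
  obtain k where k: "N = m * k" using assms(2) by (rule dvdE)
  have "x - 1 < k * m" using assms(3) k by (auto simp: mult.commute)
  then have "(x - 1) div m < k" by (rule less_mult_imp_div_less)
  then show ?thesis using k assms(1) by simp
qed

lemma block_eq:
  fixes m N b :: nat
  assumes "m > 0" "m dvd N" "b < N div m"
  shows "{y \<in> {1..N}. (y - 1) div m = b} = {b * m + 1..b * m + m}"
proof (rule set_eqI)
  fix x
  have "x \<in> {1..N} \<Longrightarrow> 1 \<le> x" by simp
  then show "x \<in> {y \<in> {1..N}. (y - 1) div m = b} \<longleftrightarrow> x \<in> {b * m + 1..b * m + m}"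
    using mem_block_iff[OF assms(1), of x b] subsetD[OF block_subset[OF assms(2,3)], of x] by blast
qed

lemma perm_symbol_cong:
  assumes "\<And>l. l \<in> {1..m} \<Longrightarrow> x l = y l"
  shows "perm_symbol m x = perm_symbol m y"
proof -
  have "(\<lambda>l. if l \<in> {1..m} then x l else l) = (\<lambda>l. if l \<in> {1..m} then y l else l)"
    using assms by auto
  moreover have "bij_betw x {1..m} {1..m} \<longleftrightarrow> bij_betw y {1..m} {1..m}"
    using assms by (rule bij_betw_cong)
  ultimately show ?thesis unfolding perm_symbol_def by simp
qed

lemma perm_symbol_permutation: "p permutes {1..m} \<Longrightarrow> perm_symbol m p = of_int (sign p)"
proof -
  assume p: "p permutes {1..m}"
  then have "(\<lambda>l. if l \<in> {1..m} then p l else l) = p" by (auto simp: permutes_def fun_eq_iff)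
  then show ?thesis using permutes_imp_bij[OF p] by (simp add: perm_symbol_def del: atLeastAtMost_iff)
qed

lemma perm_symbol_compose:
  assumes p: "p permutes {1..m}"
  shows "perm_symbol m (x \<circ> p) = of_int (sign p) * perm_symbol m x"
proof -
  let ?e = "\<lambda>x l. if l \<in> {1..m} then x l else l"
  have bij: "bij_betw (x \<circ> p) {1..m} {1..m} \<longleftrightarrow> bij_betw x {1..m} {1..m}"
    using bij_betw_comp_iff[OF permutes_imp_bij[OF p], of x "{1..m}"] by blast
  show ?thesis
  proof (cases "bij_betw x {1..m} {1..m}")
    case True
    have "?e (x \<circ> p) = ?e x \<circ> p"
      using permutes_in_image[OF p] p by (auto simp: fun_eq_iff permutes_def)
    moreover have "?e x permutes {1..m}"
      by (rule bij_imp_permutes[OF bij_betw_cong[THEN iffD2, OF _ True]]) auto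
    then have "sign (?e x \<circ> p) = sign (?e x) * sign p"
      using p by (intro sign_compose) (auto intro: permutation_permutes[THEN iffD2])
    ultimately show ?thesis using True bij by (simp add: perm_symbol_def del: atLeastAtMost_iff)
  qed (use bij in \<open>simp add: perm_symbol_def\<close>)
qed

text \<open>
  The conditions that the trivial relations impose on a linear functional, in the same terms as
  the relations themselves.
\<close>

definition block_alternating :: "nat \<Rightarrow> nat \<Rightarrow> ((nat \<Rightarrow> nat) \<Rightarrow> complex) \<Rightarrow> bool" where
  "block_alternating m N c \<longleftrightarrow>
     (\<forall>\<sigma> \<tau>. \<sigma> permutes {1..N} \<longrightarrow> \<tau> permutes {1..N} \<longrightarrow> same_blocks m N \<sigma> \<tau> \<longrightarrow>
        c \<sigma> = (-1) ^ odd_blocks m N \<sigma> \<tau> * c \<tau>)"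

lemma block_alternatingD:
  "block_alternating m N c \<Longrightarrow> \<sigma> permutes {1..N} \<Longrightarrow> \<tau> permutes {1..N} \<Longrightarrow> same_blocks m N \<sigma> \<tau> \<Longrightarrow>
     c \<sigma> = (-1) ^ odd_blocks m N \<sigma> \<tau> * c \<tau>"
  unfolding block_alternating_def by blast

text \<open>
  In block \<open>b\<close>, passing from \<open>\<sigma>\<close> to \<open>\<tau>\<close> composes the arguments of the permutation symbol with a
  permutation of \<open>{1..m}\<close> that is conjugate to \<open>block_perm m \<sigma> \<tau> b\<close>, which gives its sign.
\<close>

lemma block_alternating_eps_prod: "block_alternating m N (\<lambda>\<sigma>. eps_prod m N \<sigma> I)"
  unfolding block_alternating_def
proof (intro allI impI)
  fix \<sigma> \<tau> assume s: "\<sigma> permutes {1..N}" and t: "\<tau> permutes {1..N}" and st: "same_blocks m N \<sigma> \<tau>"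
  have factor: "perm_symbol m (\<lambda>l. I (inv \<tau> (b * m + l)))
      = of_int (sign (block_perm m \<sigma> \<tau> b)) * perm_symbol m (\<lambda>l. I (inv \<sigma> (b * m + l)))"
    if b: "b < N div m" for b
  proof -
    let ?f = "\<lambda>l. inv \<sigma> (b * m + l)" and ?g = "\<lambda>l. inv \<tau> (b * m + l)"
    let ?A = "inv \<sigma> ` {b * m + 1..b * m + m}"
    define p where "p = (\<lambda>l. if l \<in> {1..m} then inv_into {1..m} ?f (?g l) else l)"
    have shift: "(\<lambda>l. b * m + l) ` {1..m} = {b * m + 1..b * m + m}" by simp
    have inj: "inj_on ?f Y" "inj_on ?g Y" for Y
      by (rule inj_onI, drule injD[OF permutes_inj[OF permutes_inv[OF s]]], simp)
        (rule inj_onI, drule injD[OF permutes_inj[OF permutes_inv[OF t]]], simp)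
    have f: "bij_betw ?f {1..m} ?A"
      unfolding bij_betw_def shift[symmetric] image_image using inj by simp
    have A: "?A = inv \<tau> ` {b * m + 1..b * m + m}" using st b unfolding same_blocks_def by blast
    have g: "bij_betw ?g {1..m} ?A"
    proof -
      have "?g ` {1..m} = ?A" unfolding A unfolding shift[symmetric] image_image ..
      then show ?thesis using inj(2) unfolding bij_betw_def by blast
    qed
    have "bij_betw (inv_into {1..m} ?f \<circ> ?g) {1..m} {1..m}"
      by (rule bij_betw_trans[OF g bij_betw_inv_into[OF f]])
    from bij_betw_cong[THEN iffD2, OF _ this, of p] have "bij_betw p {1..m} {1..m}"
      by (simp add: p_def)
    then have p: "p permutes {1..m}" by (rule bij_imp_permutes) (simp only: p_def if_False)
    have fp: "?f (p l) = ?g l" if "l \<in> {1..m}" for l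
      using that bij_betw_inv_into_right[OF f bij_betwE[OF g, rule_format, OF that]]
      by (simp add: p_def)
    have "map_permutation {1..m} ?f p = block_perm m \<sigma> \<tau> b"
    proof
      fix x
      show "map_permutation {1..m} ?f p x = block_perm m \<sigma> \<tau> b x"
      proof (cases "\<sigma> x \<in> {b * m + 1..b * m + m}")
        case True
        then obtain l where l: "l \<in> {1..m}" "\<sigma> x = b * m + l"
          unfolding shift[symmetric] by blast
        have x: "x = ?f l" using permutes_inverses(2)[OF s, of x] l(2) by simp
        have "map_permutation {1..m} ?f p (?f l) = ?f (p l)"
          by (rule map_permutation_apply[OF inj(1) l(1)])
        also have "\<dots> = block_perm m \<sigma> \<tau> b x"
          using True l fp[OF l(1)] by (simp add: block_perm_def)
        finally show ?thesis by (simp only: x[symmetric])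
      next
        case False
        have "x \<notin> ?f ` {1..m}"
        proof
          assume "x \<in> ?f ` {1..m}"
          then obtain l where "l \<in> {1..m}" "x = ?f l" by blast
          then have "\<sigma> x \<in> {b * m + 1..b * m + m}" using permutes_inverses(1)[OF s] by auto
          with False show False by simp
        qed
        moreover have "block_perm m \<sigma> \<tau> b x = x" using False by (simp only: block_perm_def if_False)
        ultimately show ?thesis by (simp add: map_permutation_def)
      qed
    qed
    then have "sign (block_perm m \<sigma> \<tau> b) = sign p"
      using sign_map_permutation[OF inj(1)[of "{1..m}"] p] by simp
    moreover have "perm_symbol m (\<lambda>l. I (?g l)) = perm_symbol m ((\<lambda>l. I (?f l)) \<circ> p)"
      by (rule perm_symbol_cong) (simp only: o_apply fp)
    ultimately show ?thesis using perm_symbol_compose[OF p, of "\<lambda>l. I (?f l)"] by simp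
  qed
  have "(\<Prod>b<N div m. of_int (sign (block_perm m \<sigma> \<tau> b)) :: complex)
      = (\<Prod>b\<in>{..<N div m}. if \<not> evenperm (block_perm m \<sigma> \<tau> b) then -1 else 1)"
    by (intro prod.cong refl) (simp add: sign_def)
  also have "\<dots> = (-1) ^ odd_blocks m N \<sigma> \<tau>"
    by (subst prod.inter_filter[symmetric]) (simp_all add: odd_blocks_def)
  finally have "eps_prod m N \<tau> I = (-1) ^ odd_blocks m N \<sigma> \<tau> * eps_prod m N \<sigma> I"
    unfolding eps_prod_def by (simp add: factor prod.distrib cong: prod.cong_simp)
  then show "eps_prod m N \<sigma> I = (-1) ^ odd_blocks m N \<sigma> \<tau> * eps_prod m N \<tau> I"
    by (simp add: mult.assoc[symmetric] flip: power_mult_distrib)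
qed

lemma eps_prod_compose_right:
  assumes "s permutes {1..N}" "t permutes {1..N}"
  shows "eps_prod m N (t \<circ> s) (I \<circ> s) = eps_prod m N t I"
proof -
  have "inv (t \<circ> s) = inv s \<circ> inv t"
    using assms by (intro o_inv_distrib permutes_bij)
  then show ?thesis using permutes_inverses(1)[OF assms(1)] by (simp add: eps_prod_def)
qed

text \<open>
  The cut into rows in which the \<open>l\<close>-th row consists of the \<open>l\<close>-th elements of all blocks.
\<close>

definition standard_label :: "nat \<Rightarrow> nat \<Rightarrow> nat \<Rightarrow> nat" where
  "standard_label m N = (\<lambda>x\<in>{1..N}. (x - 1) mod m + 1)"

lemma standard_label_block:
  assumes "m > 0" "m dvd N" "b < N div m" "l \<in> {1..m}"
  shows "standard_label m N (b * m + l) = l"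
proof -
  have "b * m + l \<in> {1..N}" using block_subset[OF assms(2,3)] assms(4) by auto
  moreover have "(b * m + l - 1) mod m = l - 1"
  proof -
    have "b * m + l - 1 = (l - 1) + b * m" using assms(4) by simp
    then have "(b * m + l - 1) mod m = (l - 1) mod m" by (simp only: mod_mult_self1)
    moreover have "l - 1 < m" using assms(1,4) by auto
    ultimately show ?thesis by (simp only: mod_less)
  qed
  ultimately show ?thesis using assms(4) by (simp add: standard_label_def)
qed

lemma eps_prod_standard_label:
  assumes "m > 0" "m dvd N"
  shows "eps_prod m N id (standard_label m N) = 1"
  unfolding eps_prod_def
proof (intro prod.neutral ballI)
  fix b assume "b \<in> {..<N div m}"
  then have "perm_symbol m (\<lambda>l. standard_label m N (inv id (b * m + l))) = perm_symbol m id"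
    using standard_label_block[OF assms] by (intro perm_symbol_cong) simp
  then show "perm_symbol m (\<lambda>l. standard_label m N (inv id (b * m + l))) = 1"
    using perm_symbol_permutation[OF permutes_id, of m] by simp
qed

text \<open>
  The sign for \<open>\<kappa>\<close> is the same for all block-alternating functions. Evaluating it on
  \<open>eps_prod m N _ I\<close> with \<open>I = standard_label m N \<circ> \<kappa> \<circ> s\<close>, whose value at \<open>\<kappa> \<circ> s\<close> is \<open>1\<close>,
  identifies it without any computation of parities.
\<close>

lemma block_alternating_compose:
  assumes m: "m > 0" "m dvd N" and c: "block_alternating m N c" and s: "s permutes {1..N}"
    and k: "\<kappa> permutes {1..N}" "\<And>x. x \<in> {1..N} \<Longrightarrow> (\<kappa> x - 1) div m = (x - 1) div m"
  shows "c (\<kappa> \<circ> s) = eps_prod m N id (standard_label m N \<circ> \<kappa>) * c s"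
proof -
  let ?R = "standard_label m N"
  have ks: "\<kappa> \<circ> s permutes {1..N}" using permutes_compose[OF s k(1)] .
  have inv: "inv (\<kappa> \<circ> s) = inv s \<circ> inv \<kappa>" by (intro o_inv_distrib permutes_bij[OF k(1)] permutes_bij[OF s])
  have "inv \<kappa> ` {b * m + 1..b * m + m} = {b * m + 1..b * m + m}" if b: "b < N div m" for b
  proof (rule endo_inj_surj)
    show "inj_on (inv \<kappa>) {b * m + 1..b * m + m}"
      using permutes_inj[OF permutes_inv[OF k(1)]] inj_on_subset by blast
    show "inv \<kappa> ` {b * m + 1..b * m + m} \<subseteq> {b * m + 1..b * m + m}"
    proof
      fix y assume "y \<in> inv \<kappa> ` {b * m + 1..b * m + m}"
      then obtain x where x: "x \<in> {b * m + 1..b * m + m}" "y = inv \<kappa> x" by blast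
      have xN: "x \<in> {1..N}" using x(1) block_subset[OF m(2) b] by blast
      then have yN: "y \<in> {1..N}" using permutes_in_image[OF permutes_inv[OF k(1)]] x(2) by simp
      have "\<kappa> y = x" using permutes_inverses(1)[OF k(1)] x(2) by simp
      then show "y \<in> {b * m + 1..b * m + m}"
        using k(2)[OF yN] x(1) yN unfolding mem_block_iff[OF m(1)] by auto
    qed
  qed simp
  then have blocks: "same_blocks m N s (\<kappa> \<circ> s)"
    unfolding same_blocks_def inv image_comp[symmetric] by simp
  have "eps_prod m N s ((?R \<circ> \<kappa>) \<circ> s) = (-1) ^ odd_blocks m N s (\<kappa> \<circ> s) * eps_prod m N (\<kappa> \<circ> s) (?R \<circ> (\<kappa> \<circ> s))"
    using block_alternatingD[OF block_alternating_eps_prod s ks blocks] by (simp add: o_assoc)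
  also have "eps_prod m N (\<kappa> \<circ> s) (?R \<circ> (\<kappa> \<circ> s)) = 1"
    using eps_prod_compose_right[OF ks permutes_id, of m ?R] eps_prod_standard_label[OF m] by simp
  also have "eps_prod m N s ((?R \<circ> \<kappa>) \<circ> s) = eps_prod m N id (?R \<circ> \<kappa>)"
    using eps_prod_compose_right[OF s permutes_id, of m "?R \<circ> \<kappa>"] by simp
  finally have E: "eps_prod m N id (?R \<circ> \<kappa>) = (-1) ^ odd_blocks m N s (\<kappa> \<circ> s)"
    by (simp only: mult_1_right)
  show ?thesis
    unfolding E block_alternatingD[OF c s ks blocks]
    by (simp add: mult.assoc[symmetric] flip: power_mult_distrib)
qed

lemma eps_prod_transpose:
  assumes m: "m > 0" "m dvd N" and x: "x \<in> {1..N}" "y \<in> {1..N}" "x \<noteq> y" "(x - 1) div m = (y - 1) div m"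
  shows "eps_prod m N id (u \<circ> transpose x y) = - eps_prod m N id u"
proof -
  define a where "a = (x - 1) div m"
  have a: "a < N div m" using block_index_less[OF m x(1)] by (simp add: a_def)
  have "x \<in> {a * m + 1..a * m + m}" "y \<in> {a * m + 1..a * m + m}"
    unfolding mem_block_iff[OF m(1)] using x by (auto simp: a_def)
  then have xy: "x - a * m \<in> {1..m}" "y - a * m \<in> {1..m}" "x = a * m + (x - a * m)" "y = a * m + (y - a * m)"
    by auto
  define i j where "i = x - a * m" and "j = y - a * m"
  have ij: "i \<in> {1..m}" "j \<in> {1..m}" "x = a * m + i" "y = a * m + j" "i \<noteq> j"
    using xy x(3) unfolding i_def j_def by auto
  let ?P = "\<lambda>u b. perm_symbol m (\<lambda>l. u (b * m + l))"
  have same: "?P (u \<circ> transpose x y) b = ?P u b" if "b \<noteq> a" for b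
  proof (rule perm_symbol_cong)
    fix l assume l: "l \<in> {1..m}"
    then have "b * m + l \<in> {b * m + 1..b * m + m}" by auto
    then have "(b * m + l - 1) div m = b" using mem_block_iff[OF m(1)] by blast
    then have "b * m + l \<noteq> x" "b * m + l \<noteq> y" using that x(4) a_def by auto
    then show "(u \<circ> transpose x y) (b * m + l) = u (b * m + l)" by (simp add: transpose_def)
  qed
  have "?P (u \<circ> transpose x y) a = perm_symbol m ((\<lambda>l. u (a * m + l)) \<circ> transpose i j)"
    by (rule perm_symbol_cong) (auto simp: ij transpose_def)
  also have "\<dots> = - ?P u a"
    using perm_symbol_compose[OF permutes_swap_id[OF ij(1,2)]] ij(5) by (simp add: sign_swap_id)
  finally have flip: "?P (u \<circ> transpose x y) a = - ?P u a" .
  have "(\<Prod>b<N div m. ?P (u \<circ> transpose x y) b) = - (\<Prod>b<N div m. ?P u b)"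
    using a flip same by (simp add: prod.remove[of "{..<N div m}" a] cong: prod.cong_simp)
  then show ?thesis by (simp add: eps_prod_def)
qed

lemma eps_prod_not_inj:
  assumes m: "m > 0" "m dvd N" and x: "x \<in> {1..N}" "y \<in> {1..N}" "x \<noteq> y" "(x - 1) div m = (y - 1) div m"
    and u: "u x = u y"
  shows "eps_prod m N id u = 0"
proof -
  have "u \<circ> transpose x y = u" using u by (auto simp: transpose_def fun_eq_iff)
  then show ?thesis using eps_prod_transpose[OF m x, of u] by simp
qed

text \<open>
  If \<open>u\<close> takes all values on block \<open>b\<close>, then \<open>u z\<close> already occurs there, at a single \<open>y\<close>. Only
  this \<open>y\<close> contributes, because every other exchange duplicates the value \<open>u y\<close> in the block, and
  swapping equal values does nothing. If \<open>u\<close> repeats a value at \<open>p\<close> and \<open>q\<close>, the right-hand side is zero,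
  only \<open>y = p\<close> and \<open>y = q\<close> can contribute, and these two terms differ by the transposition of \<open>p\<close>
  and \<open>q\<close>, hence cancel.
\<close>

lemma eps_prod_exchange:
  assumes m: "m > 0" "m dvd N" and z: "z \<in> {1..N}" "(z - 1) div m \<noteq> b" and b: "b < N div m"
    and u: "u ` {1..N} \<subseteq> {1..m}"
  shows "(\<Sum>y | y \<in> {1..N} \<and> (y - 1) div m = b. eps_prod m N id (u \<circ> transpose z y)) = eps_prod m N id u"
proof -
  let ?C = "{y \<in> {1..N}. (y - 1) div m = b}" and ?E = "eps_prod m N id"
  have zC: "z \<notin> ?C" using z by simp
  have C: "?C = {b * m + 1..b * m + m}"
    by (rule block_eq[OF m b])
  show ?thesis
  proof (cases "inj_on u ?C")
    case True
    have "card ?C = m" unfolding C by simp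
    then have "card (u ` ?C) = card {1..m}" using card_image[OF True] by simp
    moreover have "u ` ?C \<subseteq> {1..m}" using u by auto
    ultimately have "u ` ?C = {1..m}" by (intro card_subset_eq) auto
    moreover have "u z \<in> {1..m}" using u z(1) by blast
    ultimately have "u z \<in> u ` ?C" by (simp only:)
    then obtain y where "u z = u y" "y \<in> ?C" by (rule imageE)
    then have y: "y \<in> ?C" "u y = u z" by simp_all
    have "?E (u \<circ> transpose z y') = 0" if "y' \<in> ?C - {y}" for y'
      by (rule eps_prod_not_inj[OF m, of y y']) (use that y zC in \<open>auto simp: transpose_def\<close>)
    moreover have "u \<circ> transpose z y = u" using y by (auto simp: transpose_def fun_eq_iff)
    ultimately have "?E (u \<circ> transpose z y) + (\<Sum>y\<in>?C - {y}. ?E (u \<circ> transpose z y)) = ?E u"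
      by simp
    then show ?thesis by (subst sum.remove[OF _ y(1)]) simp_all
  next
    case False
    then obtain p q where pq: "p \<in> ?C" "q \<in> ?C" "p \<noteq> q" "u p = u q" unfolding inj_on_def by blast
    have "?E (u \<circ> transpose z y) = 0" if "y \<in> ?C - {p} - {q}" for y
      by (rule eps_prod_not_inj[OF m, of p q]) (use that pq zC in \<open>auto simp: transpose_def\<close>)
    moreover have "(u \<circ> transpose z p) \<circ> transpose p q = u \<circ> transpose z q"
      using pq zC by (auto simp: transpose_def fun_eq_iff)
    then have "?E (u \<circ> transpose z q) = - ?E (u \<circ> transpose z p)"
      using eps_prod_transpose[OF m, of p q "u \<circ> transpose z p"] pq by simp
    moreover have "?E u = 0" by (rule eps_prod_not_inj[OF m, of p q]) (use pq in auto)
    ultimately have "?E (u \<circ> transpose z p) + (?E (u \<circ> transpose z q) +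
        (\<Sum>y\<in>?C - {p} - {q}. ?E (u \<circ> transpose z y))) = ?E u"
      by simp
    moreover have "q \<in> ?C - {p}" using pq by simp
    ultimately show ?thesis by (subst sum.remove[OF _ pq(1)], simp, subst sum.remove, simp_all)
  qed
qed

section \<open>Exchange relations as Garnir identities\<close>

text \<open>
  The cycle \<open>j \<mapsto> m\<close>, \<open>l \<mapsto> l - 1\<close> for \<open>j < l \<le> m\<close>; it is the permutation of positions by which
  \<open>exchange m \<sigma> i j\<close> differs from \<open>\<sigma>\<close>.
\<close>

definition cycle_down :: "nat \<Rightarrow> nat \<Rightarrow> nat \<Rightarrow> nat" where
  "cycle_down m j l = (if l = j then m else if j < l \<and> l \<le> m then l - 1 else l)"

lemma cycle_down_permutes_sign:
  assumes "j \<le> m" "1 \<le> j"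
  shows "cycle_down m j permutes {1..m} \<and> sign (cycle_down m j) = (-1) ^ (m - j)"
  using assms
proof (induction rule: inc_induct)
  case base
  have "cycle_down m m = id" by (auto simp: cycle_down_def fun_eq_iff)
  then show ?case using permutes_id[of "{1..m}"] by (simp only: sign_id diff_self_eq_0 power_0)
next
  case (step j)
  then have IH: "cycle_down m (Suc j) permutes {1..m}" "sign (cycle_down m (Suc j)) = (-1) ^ (m - Suc j)"
    by auto
  \<comment> \<open>peel off one transposition, lowering the length of the cycle by one\<close>
  have eq: "cycle_down m j = cycle_down m (Suc j) \<circ> transpose j (Suc j)"
    using step by (auto simp: cycle_down_def fun_eq_iff transpose_def)
  have t: "transpose j (Suc j) permutes {1..m}" using step by (intro permutes_swap_id) auto
  have "permutation (cycle_down m (Suc j))" using IH(1) by (auto simp: permutation_permutes)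
  then have "sign (cycle_down m j) = (-1) ^ (m - Suc j) * -1"
    unfolding eq by (simp add: sign_compose permutation_swap_id sign_swap_id IH(2))
  also have "\<dots> = (-1) ^ (m - j)"
    using step by (simp add: Suc_diff_Suc[symmetric])
  finally show ?case using permutes_compose[OF t IH(1)] unfolding eq[symmetric] by blast
qed

lemma exchange_eq_map_permutation:
  assumes "inj_on i {1..M}" "j \<in> {1..M}"
  shows "exchange M \<sigma> i j = \<sigma> \<circ> map_permutation {1..M} i (cycle_down M j)"
proof
  fix x
  show "exchange M \<sigma> i j x = (\<sigma> \<circ> map_permutation {1..M} i (cycle_down M j)) x"
  proof (cases "x \<in> i ` {1..M}")
    case True
    then obtain l where l: "l \<in> {1..M}" "x = i l" by blast
    have "map_permutation {1..M} i (cycle_down M j) x = i (cycle_down M j l)"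
      unfolding l(2) by (rule map_permutation_apply[OF assms(1) l(1)])
    moreover have "exchange M \<sigma> i j x = \<sigma> (i (cycle_down M j l))"
      using True l the_inv_into_f_f[OF assms(1) l(1)] assms(2)
      by (auto simp: exchange_def Let_def cycle_down_def)
    ultimately show ?thesis by simp
  next
    case False
    then show ?thesis by (simp add: exchange_def map_permutation_def)
  qed
qed

lemma exchange_permutes:
  assumes s: "\<sigma> permutes {1..N}" and i: "inj_on i {1..M}" "i ` {1..M} \<subseteq> {1..N}" and j: "j \<in> {1..M}"
  shows "exchange M \<sigma> i j permutes {1..N}"
proof -
  have "map_permutation {1..M} i (cycle_down M j) permutes i ` {1..M}"
    using i(1) cycle_down_permutes_sign[of j M] j
    by (intro map_permutation_permutes) (auto simp: bij_betw_def)
  then show ?thesis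
    unfolding exchange_eq_map_permutation[OF i(1) j]
    by (intro permutes_compose[OF _ s] permutes_subset[OF _ i(2)])
qed

text \<open>
  The one-box Garnir identity: moving \<open>z\<close> into block \<open>b\<close> in all possible ways.
\<close>

definition block_exchange :: "nat \<Rightarrow> nat \<Rightarrow> ((nat \<Rightarrow> nat) \<Rightarrow> complex) \<Rightarrow> bool" where
  "block_exchange m N c \<longleftrightarrow>
     (\<forall>s z b. s permutes {1..N} \<longrightarrow> z \<in> {1..N} \<longrightarrow> b < N div m \<longrightarrow> (z - 1) div m \<noteq> b \<longrightarrow>
        (\<Sum>y | y \<in> {1..N} \<and> (y - 1) div m = b. c (transpose z y \<circ> s)) = c s)"

lemma block_exchange_eps_prod:
  assumes m: "m > 0" "m dvd N" and I: "I \<in> multi_indices N m"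
  shows "block_exchange m N (\<lambda>\<sigma>. eps_prod m N \<sigma> I)"
  unfolding block_exchange_def
proof (intro allI impI)
  fix s z b assume s: "s permutes {1..N}" and z: "z \<in> {1..N}" "(z - 1) div m \<noteq> b" and b: "b < N div m"
  have "eps_prod m N (transpose z y \<circ> s) I = eps_prod m N id ((I \<circ> inv s) \<circ> transpose z y)" for y
  proof -
    have "inv (transpose z y \<circ> s) = inv s \<circ> transpose z y"
      using o_inv_distrib[OF bij_transpose permutes_bij[OF s]] by simp
    then show ?thesis by (simp add: eps_prod_def)
  qed
  moreover have "(I \<circ> inv s) ` {1..N} \<subseteq> {1..m}"
    using permutes_image[OF permutes_inv[OF s]] I
    unfolding image_comp[symmetric] multi_indices_def by (auto dest: PiE_mem)
  from eps_prod_exchange[OF m z b this]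
  have "(\<Sum>y | y \<in> {1..N} \<and> (y - 1) div m = b. eps_prod m N id ((I \<circ> inv s) \<circ> transpose z y))
      = eps_prod m N s I" by (simp add: eps_prod_def)
  ultimately show "(\<Sum>y | y \<in> {1..N} \<and> (y - 1) div m = b. eps_prod m N (transpose z y \<circ> s) I)
      = eps_prod m N s I" by (simp only:)
qed

text \<open>
  The \<open>m + 1\<close> positions which \<open>\<sigma>\<close> sends to block \<open>b\<close> and, last, to \<open>z\<close>. The exchange relations for
  these sets of positions suffice for the theorem.
\<close>

definition block_and_point :: "nat \<Rightarrow> nat \<Rightarrow> nat \<Rightarrow> (nat \<Rightarrow> nat) \<Rightarrow> nat \<Rightarrow> nat" where
  "block_and_point m b z \<sigma> l = inv \<sigma> (if l \<le> m then b * m + l else z)"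

lemma block_and_point_props:
  assumes m: "m > 0" "m dvd N" and s: "\<sigma> permutes {1..N}"
    and z: "z \<in> {1..N}" "(z - 1) div m \<noteq> b" and b: "b < N div m"
  shows "inj_on (block_and_point m b z \<sigma>) {1..m + 1}"
    and "block_and_point m b z \<sigma> ` {1..m + 1} \<subseteq> {1..N}"
proof -
  have zb: "z \<notin> {b * m + 1..b * m + m}" using z unfolding mem_block_iff[OF m(1)] by simp
  show "inj_on (block_and_point m b z \<sigma>) {1..m + 1}"
  proof (rule inj_onI)
    fix l l' assume l: "l \<in> {1..m + 1}" "l' \<in> {1..m + 1}"
      and eq: "block_and_point m b z \<sigma> l = block_and_point m b z \<sigma> l'"
    have "(if l \<le> m then b * m + l else z) = (if l' \<le> m then b * m + l' else z)"
      using eq injD[OF permutes_inj[OF permutes_inv[OF s]]] unfolding block_and_point_def by blast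
    then show "l = l'" using zb l by (auto split: if_splits)
  qed
  show "block_and_point m b z \<sigma> ` {1..m + 1} \<subseteq> {1..N}"
  proof (rule image_subsetI)
    fix l assume "l \<in> {1..m + 1}"
    then have "(if l \<le> m then b * m + l else z) \<in> {1..N}"
      using z(1) subsetD[OF block_subset[OF m(2) b], of "b * m + l"] by auto
    then show "block_and_point m b z \<sigma> l \<in> {1..N}"
      unfolding block_and_point_def using permutes_in_image[OF permutes_inv[OF s]] by blast
  qed
qed

text \<open>
  The \<open>j\<close>-th exchange puts \<open>z\<close> in the place of the \<open>j\<close>-th element of the block, up to a cycle inside
  the block. That cycle costs a sign that does not depend on the function, and this makes the alternating
  sum over \<open>j\<close> a plain sum in the next lemma.
\<close>

lemma exchange_block_and_point:
  assumes m: "m > 0" "m dvd N" and s: "\<sigma> permutes {1..N}"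
    and z: "z \<in> {1..N}" "(z - 1) div m \<noteq> b" and b: "b < N div m" and j: "j \<in> {1..m}"
  shows "exchange (m + 1) \<sigma> (block_and_point m b z \<sigma>) j
           = map_permutation {1..m} ((+) (b * m)) (cycle_down m j) \<circ> (transpose z (b * m + j) \<circ> \<sigma>)"
proof
  let ?i = "block_and_point m b z \<sigma>" and ?k = "map_permutation {1..m} ((+) (b * m)) (cycle_down m j)"
  have zb: "z \<notin> {b * m + 1..b * m + m}" using z unfolding mem_block_iff[OF m(1)] by simp
  note inj = block_and_point_props(1)[OF m s z b]
  have si: "\<sigma> (?i l) = (if l \<le> m then b * m + l else z)" for l
    using permutes_inverses(1)[OF s] by (simp add: block_and_point_def)
  have shift: "(+) (b * m) ` {1..m} = {b * m + 1..b * m + m}" by simp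
  have k1: "?k (b * m + l) = b * m + cycle_down m j l" if "l \<in> {1..m}" for l
    using map_permutation_apply[of "(+) (b * m)" "{1..m}" l "cycle_down m j"] that by simp
  have k2: "?k x = x" if "x \<notin> {b * m + 1..b * m + m}" for x
    using that unfolding shift[symmetric] by (simp add: map_permutation_def del: image_add_atLeastAtMost)
  fix x
  show "exchange (m + 1) \<sigma> ?i j x = (?k \<circ> (transpose z (b * m + j) \<circ> \<sigma>)) x"
  proof (cases "x \<in> ?i ` {1..m + 1}")
    case True
    then obtain l where l: "l \<in> {1..m + 1}" "x = ?i l" by blast
    have L: "exchange (m + 1) \<sigma> ?i j x = (if l < j then \<sigma> (?i l) else if l = j then \<sigma> (?i (m + 1)) else \<sigma> (?i (l - 1)))"
      using True l the_inv_into_f_f[OF inj l(1)] by (auto simp: exchange_def Let_def)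
    consider "l < j" | "l = j" | "j < l" "l \<le> m" | "l = m + 1" using l(1) by force
    then show ?thesis
    proof cases
      case 1
      then have "b * m + l \<noteq> z" "l \<in> {1..m}" using zb l j by auto
      then show ?thesis using 1 L si k1[of l] l j by (simp add: transpose_def cycle_down_def)
    next
      case 2
      then show ?thesis using L si k2[OF zb] l j by (simp add: transpose_def)
    next
      case 3
      then have "b * m + l \<noteq> z" "l \<in> {1..m}" "l - 1 \<le> m" using zb l j by auto
      then show ?thesis using 3 L si k1[of l] l j by (simp add: transpose_def cycle_down_def)
    next
      case 4
      then show ?thesis using L si k1[of j] l j by (simp add: transpose_def cycle_down_def)
    qed
  next
    case False
    have "\<sigma> x \<noteq> z"
    proof
      assume "\<sigma> x = z"
      then have "x = ?i (m + 1)" using permutes_inverses(2)[OF s, of x] by (simp add: block_and_point_def)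
      with False show False by auto
    qed
    moreover have nb: "\<sigma> x \<notin> {b * m + 1..b * m + m}"
    proof
      assume "\<sigma> x \<in> {b * m + 1..b * m + m}"
      then obtain l where l: "l \<in> {1..m}" "\<sigma> x = b * m + l" unfolding shift[symmetric] by blast
      then have "x = ?i l" using permutes_inverses(2)[OF s, of x] by (simp add: block_and_point_def)
      with False l(1) show False by auto
    qed
    moreover have "\<sigma> x \<noteq> b * m + j" using nb j by auto
    ultimately have "transpose z (b * m + j) (\<sigma> x) = \<sigma> x" by (simp add: transpose_def)
    moreover have "exchange (m + 1) \<sigma> ?i j x = \<sigma> x" using False by (simp only: exchange_def if_False)
    ultimately show ?thesis using k2[OF nb] by simp
  qed
qed

text \<open>
  Applied to a functional that vanishes on the exchange relations, this lemma yields the Garnir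
  identity. Applied to \<open>eps_prod\<close>, which satisfies the Garnir identity, it shows that the alternating sums
  are relations.
\<close>

lemma sum_exchange_block_and_point:
  assumes m: "m > 0" "m dvd N" and c: "block_alternating m N c" and s: "\<sigma> permutes {1..N}"
    and z: "z \<in> {1..N}" "(z - 1) div m \<noteq> b" and b: "b < N div m"
  shows "(\<Sum>j=1..m + 1. (-1) ^ (j + 1) * c (exchange (m + 1) \<sigma> (block_and_point m b z \<sigma>) j))
     = (-1) ^ m * (c \<sigma> - (\<Sum>y | y \<in> {1..N} \<and> (y - 1) div m = b. c (transpose z y \<circ> \<sigma>)))"
proof -
  let ?e = "\<lambda>j. exchange (m + 1) \<sigma> (block_and_point m b z \<sigma>) j"
  have shift: "(+) (b * m) ` {1..m} = {b * m + 1..b * m + m}" by simp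
  have summand: "c (?e j) = (-1) ^ (m - j) * c (transpose z (b * m + j) \<circ> \<sigma>)" if j: "j \<in> {1..m}" for j
  proof -
    let ?k = "map_permutation {1..m} ((+) (b * m)) (cycle_down m j)"
    have cyc: "cycle_down m j permutes {1..m}" "sign (cycle_down m j) = (-1) ^ (m - j)"
      using cycle_down_permutes_sign[of j m] j by auto
    have k0: "?k permutes {b * m + 1..b * m + m}"
      unfolding shift[symmetric] by (rule map_permutation_permutes[OF _ cyc(1)]) (simp add: bij_betw_def)
    then have k: "?k permutes {1..N}" by (rule permutes_subset[OF _ block_subset[OF m(2) b]])
    have k2: "?k x = x" if "x \<notin> {b * m + 1..b * m + m}" for x
      using k0 that unfolding permutes_def by blast
    have pres: "(?k x - 1) div m = (x - 1) div m" for x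
    proof (cases "x \<in> {b * m + 1..b * m + m}")
      case True
      then have "?k x \<in> {b * m + 1..b * m + m}" using permutes_in_image[OF k0] by blast
      then show ?thesis using True unfolding mem_block_iff[OF m(1)] by simp
    next
      case False
      then have "?k x = x" by (rule k2)
      then show ?thesis by simp
    qed
    have t: "transpose z (b * m + j) \<circ> \<sigma> permutes {1..N}"
      using subsetD[OF block_subset[OF m(2) b], of "b * m + j"] j z(1)
      by (intro permutes_compose[OF s] permutes_swap_id) auto
    let ?P = "\<lambda>u b. perm_symbol m (\<lambda>l. u (b * m + l))"
    have "?P (standard_label m N \<circ> ?k) b' = (if b' = b then (-1) ^ (m - j) else 1)"
      if b': "b' < N div m" for b'
    proof (cases "b' = b")
      case True
      have "?P (standard_label m N \<circ> ?k) b = perm_symbol m (cycle_down m j)"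
      proof (rule perm_symbol_cong)
        fix l assume l: "l \<in> {1..m}"
        have "?k (b * m + l) = b * m + cycle_down m j l"
          using map_permutation_apply[of "(+) (b * m)" "{1..m}" l "cycle_down m j"] l by simp
        moreover have "cycle_down m j l \<in> {1..m}" using permutes_in_image[OF cyc(1)] l by blast
        ultimately show "(standard_label m N \<circ> ?k) (b * m + l) = cycle_down m j l"
          using standard_label_block[OF m b] by simp
      qed
      then show ?thesis using True perm_symbol_permutation[OF cyc(1)] cyc(2) by simp
    next
      case False
      have "?P (standard_label m N \<circ> ?k) b' = perm_symbol m id"
      proof (rule perm_symbol_cong)
        fix l assume l: "l \<in> {1..m}"
        then have "b' * m + l \<in> {b' * m + 1..b' * m + m}" by simp
        then have "b' * m + l \<notin> {b * m + 1..b * m + m}"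
          using False unfolding mem_block_iff[OF m(1)] by simp
        then show "(standard_label m N \<circ> ?k) (b' * m + l) = id l"
          using k2 standard_label_block[OF m b' l] by simp
      qed
      then show ?thesis using False perm_symbol_permutation[OF permutes_id, of m] by simp
    qed
    then have "eps_prod m N id (standard_label m N \<circ> ?k) = (\<Prod>b'<N div m. if b' = b then (-1) ^ (m - j) else 1)"
      unfolding eps_prod_def by (intro prod.cong refl) simp
    also have "\<dots> = (-1) ^ (m - j)" using b by (simp add: prod.delta)
    finally show ?thesis
      unfolding exchange_block_and_point[OF m s z b j]
      using block_alternating_compose[OF m c t k pres] by simp
  qed
  have "?e (m + 1) = \<sigma>"
  proof -
    have "cycle_down (m + 1) (m + 1) = id" by (auto simp: cycle_down_def fun_eq_iff)
    then show ?thesis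
      using exchange_eq_map_permutation[OF block_and_point_props(1)[OF m s z b], of "m + 1" \<sigma>]
        map_permutation_id'[OF block_and_point_props(1)[OF m s z b]] by simp
  qed
  then have "(\<Sum>j=1..m + 1. (-1) ^ (j + 1) * c (?e j))
      = (-1) ^ m * c \<sigma> + (\<Sum>j=1..m. (-1) ^ (j + 1) * c (?e j))"
    by simp
  also have "(\<Sum>j=1..m. (-1) ^ (j + 1) * c (?e j)) = (\<Sum>j=1..m. - ((-1) ^ m * c (transpose z (b * m + j) \<circ> \<sigma>)))"
  proof (rule sum.cong[OF refl])
    fix j assume j: "j \<in> {1..m}"
    have "(-1::complex) ^ (j + 1) * (-1) ^ (m - j) = (-1) ^ (m + 1)"
      using j by (simp flip: power_add)
    then show "(-1) ^ (j + 1) * c (?e j) = - ((-1) ^ m * c (transpose z (b * m + j) \<circ> \<sigma>))"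
      unfolding summand[OF j] by (simp only: mult.assoc[symmetric]) simp
  qed
  also have "\<dots> = - ((-1) ^ m * (\<Sum>j=1..m. c (transpose z (b * m + j) \<circ> \<sigma>)))"
    by (simp only: sum_negf sum_distrib_left)
  also have "(\<Sum>j=1..m. c (transpose z (b * m + j) \<circ> \<sigma>))
      = (\<Sum>y | y \<in> {1..N} \<and> (y - 1) div m = b. c (transpose z y \<circ> \<sigma>))"
    unfolding block_eq[OF m b] shift[symmetric]
    by (subst sum.reindex) (simp_all del: image_add_atLeastAtMost)
  finally show ?thesis by (simp add: algebra_simps)
qed

section \<open>Reconstruction from coordinates\<close>

lemma exchange_function_right_translate:
  assumes m: "m > 0" "m dvd N" and c: "block_alternating m N c" "block_exchange m N c"
    and s: "\<sigma> permutes {1..N}"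
  shows "exchange_function {1..N} {..<N div m} (\<lambda>x. (x - 1) div m) (\<lambda>p. c (p \<circ> \<sigma>))"
  unfolding exchange_function_def
proof (intro conjI allI impI)
  fix p x y assume p: "p permutes {1..N}" and x: "x \<in> {1..N}" "y \<in> {1..N}" "x \<noteq> y" "(x - 1) div m = (y - 1) div m"
  have ps: "p \<circ> \<sigma> permutes {1..N}" by (rule permutes_compose[OF s p])
  have "c (transpose x y \<circ> (p \<circ> \<sigma>)) = eps_prod m N id (standard_label m N \<circ> transpose x y) * c (p \<circ> \<sigma>)"
    by (rule block_alternating_compose[OF m c(1) ps permutes_swap_id[OF x(1,2)]])
      (use x(4) in \<open>auto simp: transpose_def\<close>)
  also have "eps_prod m N id (standard_label m N \<circ> transpose x y) = -1"
    using eps_prod_transpose[OF m x] eps_prod_standard_label[OF m] by simp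
  finally show "c (transpose x y \<circ> p \<circ> \<sigma>) = - c (p \<circ> \<sigma>)"
    by (simp only: o_assoc mult_minus_left mult_1_left)
next
  fix p z b assume p: "p permutes {1..N}" and z: "z \<in> {1..N}" "b \<in> {..<N div m}" "(z - 1) div m \<noteq> b"
  have ps: "p \<circ> \<sigma> permutes {1..N}" by (rule permutes_compose[OF s p])
  then show "(\<Sum>y | y \<in> {1..N} \<and> (y - 1) div m = b. c (transpose z y \<circ> p \<circ> \<sigma>)) = c (p \<circ> \<sigma>)"
    using c(2) z unfolding block_exchange_def by (simp add: o_assoc[symmetric])
qed

text \<open>
  The permutation inside the blocks that carries the cut \<open>R\<close> to the standard one.
\<close>

definition column_permutation :: "nat \<Rightarrow> nat \<Rightarrow> (nat \<Rightarrow> nat) \<Rightarrow> nat \<Rightarrow> nat" where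
  "column_permutation m N R x = (if x \<in> {1..N} then (x - 1) div m * m + R x else x)"

lemma column_permutation_props:
  assumes m: "m > 0" "m dvd N"
    and R: "R \<in> block_labellings m {1..N} {..<N div m} (\<lambda>x. (x - 1) div m)"
  shows "column_permutation m N R permutes {1..N}"
    and "x \<in> {1..N} \<Longrightarrow> (column_permutation m N R x - 1) div m = (x - 1) div m"
    and "standard_label m N \<circ> column_permutation m N R = R"
proof -
  let ?k = "column_permutation m N R"
  have Rm: "R x \<in> {1..m}" if "x \<in> {1..N}" for x
    using R that unfolding block_labellings_def by (auto dest: PiE_mem)
  have k: "?k x = (x - 1) div m * m + R x" if "x \<in> {1..N}" for x
    using that by (simp only: column_permutation_def if_True)
  have kb: "?k x \<in> {(x - 1) div m * m + 1..(x - 1) div m * m + m}" if "x \<in> {1..N}" for x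
    using k[OF that] Rm[OF that] by simp
  show div: "(?k x - 1) div m = (x - 1) div m" if "x \<in> {1..N}" for x
    using kb[OF that] unfolding mem_block_iff[OF m(1)] by simp
  have kN: "?k ` {1..N} \<subseteq> {1..N}"
    using kb block_subset[OF m(2) block_index_less[OF m]] by blast
  have "inj_on ?k {1..N}"
  proof (rule inj_onI)
    fix x y assume xy: "x \<in> {1..N}" "y \<in> {1..N}" "?k x = ?k y"
    then have d: "(x - 1) div m = (y - 1) div m" using div by metis
    then have e: "R x = R y" using xy(3) k[OF xy(1)] k[OF xy(2)] by simp
    have inj: "inj_on R {u \<in> {1..N}. (u - 1) div m = (x - 1) div m}"
      using R block_index_less[OF m xy(1)] unfolding block_labellings_def bij_betw_def by blast
    have mem: "x \<in> {u \<in> {1..N}. (u - 1) div m = (x - 1) div m}"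
        "y \<in> {u \<in> {1..N}. (u - 1) div m = (x - 1) div m}"
      using xy(1,2) d[symmetric] by simp_all
    show "x = y" by (rule inj_onD[OF inj e mem])
  qed
  then have "bij_betw ?k {1..N} {1..N}"
    using endo_inj_surj[OF finite_atLeastAtMost kN] unfolding bij_betw_def by blast
  then show "?k permutes {1..N}" by (rule bij_imp_permutes) (simp only: column_permutation_def if_False)
  show "standard_label m N \<circ> ?k = R"
  proof
    fix x
    show "(standard_label m N \<circ> ?k) x = R x"
    proof (cases "x \<in> {1..N}")
      case True
      then show ?thesis
        using standard_label_block[OF m block_index_less[OF m True] Rm[OF True]] k[OF True] by simp
    next
      case False
      have "R x = undefined" using R False unfolding block_labellings_def by blast
      moreover have "?k x = x" using False by (simp only: column_permutation_def if_False)
      ultimately show ?thesis using False by (simp only: o_apply standard_label_def restrict_apply if_False)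
    qed
  qed
qed

lemma eps_prod_nonzero_imp_block_labelling:
  assumes m: "m > 0" "m dvd N" and I: "I \<in> multi_indices N m" and nz: "eps_prod m N id I \<noteq> 0"
  shows "I \<in> block_labellings m {1..N} {..<N div m} (\<lambda>x. (x - 1) div m)"
proof -
  have "bij_betw I {x \<in> {1..N}. (x - 1) div m = b} {1..m}" if b: "b \<in> {..<N div m}" for b
  proof -
    have "perm_symbol m (\<lambda>l. I (b * m + l)) \<noteq> 0" using nz b unfolding eps_prod_def by simp
    then have "bij_betw (\<lambda>l. I (b * m + l)) {1..m} {1..m}"
      unfolding perm_symbol_def by (simp split: if_splits)
    then have "bij_betw (I \<circ> (+) (b * m)) {1..m} {1..m}" by (simp only: o_def)
    moreover have "bij_betw ((+) (b * m)) {1..m} {b * m + 1..b * m + m}" by (simp add: bij_betw_def)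
    ultimately have "bij_betw I {b * m + 1..b * m + m} {1..m}"
      using bij_betw_comp_iff[of "(+) (b * m)" "{1..m}" "{b * m + 1..b * m + m}" I "{1..m}"] by blast
    moreover have "b < N div m" using b by simp
    ultimately show ?thesis by (simp only: block_eq[OF m])
  qed
  then show ?thesis using I unfolding block_labellings_def multi_indices_def by blast
qed

lemma standard_label_compose_multi_index:
  assumes "m > 0" "\<tau> permutes {1..N}"
  shows "standard_label m N \<circ> \<tau> \<in> multi_indices N m"
proof (unfold multi_indices_def, rule PiE_I)
  fix x assume "x \<in> {1..N}"
  then have "\<tau> x \<in> {1..N}" using permutes_in_image[OF assms(2)] by blast
  then show "(standard_label m N \<circ> \<tau>) x \<in> {1..m}"
    using mod_less_divisor[OF assms(1), of "\<tau> x - 1"] by (simp add: standard_label_def Suc_le_eq)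
next
  fix x assume x: "x \<notin> {1..N}"
  then have "\<tau> x = x" using assms(2) unfolding permutes_def by blast
  then show "(standard_label m N \<circ> \<tau>) x = undefined"
    using x by (simp only: o_apply standard_label_def restrict_apply if_False)
qed

text \<open>
  For \<open>N = m * v\<close> this is the product of the hook lengths of a rectangle with \<open>m\<close> rows and \<open>v\<close> columns.
\<close>

definition block_factor :: "nat \<Rightarrow> nat \<Rightarrow> complex" where
  "block_factor m N = of_nat (\<Prod>i=1..m. \<Prod>j<N div m. i + j)"

lemma block_factor_nonzero: "block_factor m N \<noteq> 0"
  unfolding block_factor_def by (simp only: of_nat_eq_0_iff) auto

text \<open>
  On the right, \<open>standard_label m N \<circ> \<tau> \<circ> inv \<sigma>\<close> must be a cut \<open>R\<close> into rows for the coefficient to be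
  nonzero. For given \<open>R\<close>, the permutations \<open>\<tau> \<circ> inv \<sigma>\<close> in question are \<open>\<kappa> \<circ> p\<close>, where \<open>\<kappa>\<close> is
  \<open>column_permutation m N R\<close> and \<open>p\<close> preserves \<open>R\<close>. The sign of \<open>\<kappa>\<close> occurs once in the coefficient and
  once in \<open>c (\<kappa> \<circ> p \<circ> \<sigma>)\<close>, so it cancels, and \<open>sum_over_block_labellings\<close> applies.
\<close>

lemma block_exchange_reconstruction:
  assumes m: "m > 0" "m dvd N" and c: "block_alternating m N c" "block_exchange m N c"
    and s: "\<sigma> permutes {1..N}"
  shows "block_factor m N * c \<sigma>
    = (\<Sum>\<tau> | \<tau> permutes {1..N}. eps_prod m N \<sigma> (standard_label m N \<circ> \<tau>) * c \<tau>)"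
proof -
  let ?X = "{1..N}" and ?B = "{..<N div m}" and ?col = "\<lambda>x. (x - 1) div m" and ?R0 = "standard_label m N"
  let ?L = "block_labellings m ?X ?B ?col"
  let ?d = "\<lambda>p. c (p \<circ> \<sigma>)" and ?E = "eps_prod m N id"
  have card: "card {x \<in> ?X. ?col x = b} = m" if "b \<in> ?B" for b
    using block_eq[OF m, of b] that by simp
  have col: "?col ` ?X \<subseteq> ?B" using block_index_less[OF m] by blast
  have finP: "finite {\<tau>. \<tau> permutes ?X}" by (rule finite_permutations) simp
  have finL: "finite ?L"
    by (rule finite_subset[of _ "?X \<rightarrow>\<^sub>E {1..m}"]) (auto simp: block_labellings_def intro!: finite_PiE)
  have fibre: "(\<Sum>\<tau> | \<tau> \<in> {\<tau>. \<tau> permutes ?X \<and> ?R0 \<circ> \<tau> \<in> ?L} \<and> ?R0 \<circ> \<tau> = R. ?E (?R0 \<circ> \<tau>) * ?d \<tau>)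
      = (\<Sum>p | p permutes ?X \<and> (\<forall>x\<in>?X. R (p x) = R x). ?d p)" if R: "R \<in> ?L" for R
  proof -
    let ?k = "column_permutation m N R"
    note k = column_permutation_props[OF m R]
    \<comment> \<open>the permutation carrying \<open>R\<close> to the standard labelling undoes its own sign\<close>
    have EE: "?E R * ?E R = 1"
    proof -
      have "eps_prod m N (?k \<circ> id) (?R0 \<circ> ?k) = ?E (?R0 \<circ> ?k) * ?E (?R0 \<circ> ?k)"
        by (rule block_alternating_compose[OF m block_alternating_eps_prod permutes_id k(1,2)])
      moreover have "eps_prod m N (?k \<circ> id) (?R0 \<circ> ?k) = 1"
        using eps_prod_compose_right[OF k(1) permutes_id, of m ?R0] eps_prod_standard_label[OF m] by simp
      ultimately show ?thesis unfolding k(3) by simp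
    qed
    show ?thesis
    proof (rule sum.reindex_bij_witness[where i = "\<lambda>p. ?k \<circ> p" and j = "\<lambda>\<tau>. inv ?k \<circ> \<tau>"])
      fix \<tau> assume "\<tau> \<in> {\<tau>. \<tau> \<in> {\<tau>. \<tau> permutes ?X \<and> ?R0 \<circ> \<tau> \<in> ?L} \<and> ?R0 \<circ> \<tau> = R}"
      then have t: "\<tau> permutes ?X" "?R0 \<circ> \<tau> = R" by auto
      show kk: "?k \<circ> (inv ?k \<circ> \<tau>) = \<tau>"
        using permutes_inverses(1)[OF k(1)] by (simp add: fun_eq_iff)
      have p: "inv ?k \<circ> \<tau> permutes ?X" by (rule permutes_compose[OF t(1) permutes_inv[OF k(1)]])
      have "R ((inv ?k \<circ> \<tau>) x) = R x" for x
        using k(3) t(2) permutes_inverses(1)[OF k(1)] by (metis comp_apply)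
      then show "inv ?k \<circ> \<tau> \<in> {p. p permutes ?X \<and> (\<forall>x\<in>?X. R (p x) = R x)}" using p by blast
      have "c (?k \<circ> ((inv ?k \<circ> \<tau>) \<circ> \<sigma>)) = ?E (?R0 \<circ> ?k) * ?d (inv ?k \<circ> \<tau>)"
        by (rule block_alternating_compose[OF m c(1) permutes_compose[OF s p] k(1,2)])
      moreover have "?k \<circ> ((inv ?k \<circ> \<tau>) \<circ> \<sigma>) = \<tau> \<circ> \<sigma>" unfolding o_assoc[symmetric] using kk by (simp add: o_assoc)
      ultimately have "?d \<tau> = ?E R * ?d (inv ?k \<circ> \<tau>)" unfolding k(3) by simp
      then show "?d (inv ?k \<circ> \<tau>) = ?E (?R0 \<circ> \<tau>) * ?d \<tau>"
        unfolding t(2) using EE by (simp add: mult.assoc[symmetric])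
    next
      fix p assume "p \<in> {p. p permutes ?X \<and> (\<forall>x\<in>?X. R (p x) = R x)}"
      then have p: "p permutes ?X" "\<And>x. x \<in> ?X \<Longrightarrow> R (p x) = R x" by auto
      show "inv ?k \<circ> (?k \<circ> p) = p" using permutes_inverses(2)[OF k(1)] by (simp add: fun_eq_iff)
      have "R \<circ> p = R"
      proof
        fix x show "(R \<circ> p) x = R x"
          by (cases "x \<in> ?X") (use p in \<open>auto simp: permutes_def\<close>)
      qed
      then have "?R0 \<circ> (?k \<circ> p) = R" using k(3) by (simp add: o_assoc)
      then show "?k \<circ> p \<in> {\<tau>. \<tau> \<in> {\<tau>. \<tau> permutes ?X \<and> ?R0 \<circ> \<tau> \<in> ?L} \<and> ?R0 \<circ> \<tau> = R}"
        using permutes_compose[OF p(1) k(1)] R by simp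
    qed
  qed
  have "(\<Sum>\<tau> | \<tau> permutes ?X. eps_prod m N \<sigma> (?R0 \<circ> \<tau>) * c \<tau>)
      = (\<Sum>\<tau> | \<tau> permutes ?X. eps_prod m N \<sigma> (?R0 \<circ> (\<tau> \<circ> \<sigma>)) * c (\<tau> \<circ> \<sigma>))"
    by (rule sum_permutations_compose_right[OF s])
  also have "\<dots> = (\<Sum>\<tau> | \<tau> permutes ?X. ?E (?R0 \<circ> \<tau>) * ?d \<tau>)"
    using eps_prod_compose_right[OF s permutes_id, of m] by (simp add: o_assoc)
  also have "\<dots> = (\<Sum>\<tau> | \<tau> permutes ?X \<and> ?R0 \<circ> \<tau> \<in> ?L. ?E (?R0 \<circ> \<tau>) * ?d \<tau>)"
    by (rule sum.mono_neutral_right[OF finP])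
      (use eps_prod_nonzero_imp_block_labelling[OF m standard_label_compose_multi_index[OF m(1)]] in auto)
  also have "\<dots> = (\<Sum>R\<in>?L. \<Sum>\<tau> | \<tau> \<in> {\<tau>. \<tau> permutes ?X \<and> ?R0 \<circ> \<tau> \<in> ?L} \<and> ?R0 \<circ> \<tau> = R. ?E (?R0 \<circ> \<tau>) * ?d \<tau>)"
    by (rule sum.group[symmetric]) (use finP finL in auto)
  also have "\<dots> = (\<Sum>R\<in>?L. \<Sum>p | p permutes ?X \<and> (\<forall>x\<in>?X. R (p x) = R x). ?d p)"
    by (intro sum.cong refl fibre)
  also have "\<dots> = block_factor m N * ?d id"
    using sum_over_block_labellings[OF exchange_function_right_translate[OF m c s] _ _ col card]
    by (simp add: block_factor_def)
  finally show ?thesis by simp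
qed

section \<open>Coordinates of the symmetrized elements\<close>

lemma sum_fun_apply: "(\<Sum>a\<in>A. f a) x = (\<Sum>a\<in>A. f a x)" for f :: "'a \<Rightarrow> 'b \<Rightarrow> complex"
  by (induction A rule: infinite_finite_induct) simp_all

text \<open>
  Extend a basis of the span by \<open>x\<close>, and prescribe the values on this linearly independent set.
\<close>

lemma separating_functional:
  fixes x :: "'x \<Rightarrow> complex"
  assumes "x \<notin> cfun.span G"
  obtains \<phi> where "Vector_Spaces.linear scl (*) \<phi>" "\<And>g. g \<in> G \<Longrightarrow> \<phi> g = 0" "\<phi> x = 1"
proof -
  interpret P: vector_space_pair "scl :: complex \<Rightarrow> ('x \<Rightarrow> complex) \<Rightarrow> _" "(*) :: complex \<Rightarrow> _"
    by unfold_locales (auto simp: algebra_simps)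
  obtain B where B: "B \<subseteq> G" "cfun.independent B" "G \<subseteq> cfun.span B"
    by (rule cfun.maximal_independent_subset)
  have "x \<notin> cfun.span B" using cfun.span_mono[OF B(1)] assms by blast
  then have ind: "cfun.independent (insert x B)" using B(2) by (rule cfun.independent_insertI)
  obtain \<phi> where \<phi>: "Vector_Spaces.linear scl (*) \<phi>" "\<And>y. y \<in> insert x B \<Longrightarrow> \<phi> y = (if y = x then 1 else 0)"
    using P.linear_independent_extend[OF ind, of "\<lambda>y. if y = x then 1 else 0"] by blast
  have "x \<notin> B" using cfun.span_base \<open>x \<notin> cfun.span B\<close> by blast
  then have B0: "\<phi> y = 0" if "y \<in> B" for y using \<phi>(2)[of y] that by auto
  have "\<phi> g = 0" if "g \<in> G" for g
    by (rule P.linear_eq_0_on_span[OF \<phi>(1) B0]) (use that B(3) in blast)+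
  then show thesis using that[OF \<phi>(1)] \<phi>(2)[of x] by simp
qed

lemma pair_perm_compose:
  assumes "\<rho>' permutes {1..r}"
  shows "pair_perm (\<rho> \<circ> \<rho>') = pair_perm \<rho> \<circ> pair_perm \<rho>'"
proof
  fix p
  have pos: "\<rho>' a \<ge> 1" if "a \<ge> 1" for a
    using permutes_in_image[OF assms, of a] assms that by (cases "a \<in> {1..r}") (auto simp: permutes_def)
  let ?a = "\<rho>' ((p + 1) div 2)"
  have "(2 * ?a - p mod 2 + 1) div 2 = ?a \<and> (2 * ?a - p mod 2) mod 2 = p mod 2"
  proof (cases "even p")
    case False
    then obtain q where "p = 2 * q + 1" by (elim oddE)
    then have "?a \<ge> 1" by (intro pos) auto
    then obtain b where "?a = Suc b" by (cases ?a) auto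
    with False show ?thesis by (simp add: odd_iff_mod_2_eq_one)
  qed auto
  then show "pair_perm (\<rho> \<circ> \<rho>') p = (pair_perm \<rho> \<circ> pair_perm \<rho>') p" by (simp add: pair_perm_def)
qed

lemma pair_perm_permutes:
  assumes "\<rho> permutes {1..r}"
  shows "pair_perm \<rho> permutes {1..2 * r}"
proof -
  have id: "pair_perm id = id"
  proof
    fix p show "pair_perm id p = id p"
      by (cases "even p") (auto simp: pair_perm_def elim!: evenE oddE)
  qed
  have inv: "pair_perm \<rho> (pair_perm (inv \<rho>) p) = p" "pair_perm (inv \<rho>) (pair_perm \<rho> p) = p" for p
    using pair_perm_compose[OF permutes_inv[OF assms], of \<rho>] pair_perm_compose[OF assms, of "inv \<rho>"]
    by (simp_all add: permutes_inv_o[OF assms] id fun_eq_iff)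
  have "pair_perm \<rho> p = p" if "p \<notin> {1..2 * r}" for p
  proof -
    have "(p + 1) div 2 \<notin> {1..r}" using that by auto
    then have "\<rho> ((p + 1) div 2) = (p + 1) div 2" using assms unfolding permutes_def by blast
    then have "pair_perm \<rho> p = pair_perm id p" by (simp add: pair_perm_def)
    then show ?thesis by (simp add: id)
  qed
  then show ?thesis unfolding permutes_def using inv by metis
qed

lemma multi_indices_compose:
  assumes "p permutes {1..N}"
  shows "I \<circ> p \<in> multi_indices N m \<longleftrightarrow> I \<in> multi_indices N m"
proof -
  have *: "I \<circ> p \<in> multi_indices N m" if p: "p permutes {1..N}" and I: "I \<in> multi_indices N m" for p I
    unfolding multi_indices_def
  proof (rule PiE_I)
    fix x assume "x \<in> {1..N}"
    then have "p x \<in> {1..N}" using permutes_in_image[OF p] by blast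
    then show "(I \<circ> p) x \<in> {1..m}"
      using PiE_mem[of I "{1..N}" "\<lambda>_. {1..m}" "p x"] I unfolding multi_indices_def by simp
  next
    fix x assume x: "x \<notin> {1..N}"
    then have "p x = x" using p unfolding permutes_def by blast
    then show "(I \<circ> p) x = undefined"
      using PiE_arb[OF I[unfolded multi_indices_def] x] by simp
  qed
  have "I \<circ> p \<circ> inv p = I" by (simp add: o_assoc[symmetric] permutes_inv_o[OF assms])
  then show ?thesis using *[OF assms] *[OF permutes_inv[OF assms], of "I \<circ> p"] by auto
qed

lemma det_tensor_apply:
  "det_tensor m N \<sigma> I = (if I \<in> multi_indices N m then eps_prod m N \<sigma> I else 0)"
proof -
  have "finite (multi_indices N m)" unfolding multi_indices_def by (intro finite_PiE) auto
  then show ?thesis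
    by (simp add: det_tensor_def sum_fun_apply scl_def unit_fun_def if_distrib[of "(*) _"] sum.delta cong: if_cong)
qed

lemma sym_elem_apply:
  "sym_elem n k r (\<sigma>, \<eta>) (I, J) =
     (if I \<in> multi_indices (2 * r) n \<and> J \<in> multi_indices r k
      then (\<Sum>\<rho> | \<rho> permutes {1..r}. eps_prod n (2 * r) \<sigma> (I \<circ> pair_perm \<rho>) * eps_prod k r \<eta> (J \<circ> \<rho>)) / fact r
      else 0)"
proof -
  have "(\<Sum>\<rho> | \<rho> permutes {1..r}. det_tensor n (2 * r) \<sigma> (I \<circ> pair_perm \<rho>) * det_tensor k r \<eta> (J \<circ> \<rho>))
    = (\<Sum>\<rho> | \<rho> permutes {1..r}. if I \<in> multi_indices (2 * r) n \<and> J \<in> multi_indices r k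
        then eps_prod n (2 * r) \<sigma> (I \<circ> pair_perm \<rho>) * eps_prod k r \<eta> (J \<circ> \<rho>) else 0)"
    by (intro sum.cong refl)
      (simp add: det_tensor_apply multi_indices_compose[OF pair_perm_permutes] multi_indices_compose)
  also have "\<dots> = (if I \<in> multi_indices (2 * r) n \<and> J \<in> multi_indices r k
      then \<Sum>\<rho> | \<rho> permutes {1..r}. eps_prod n (2 * r) \<sigma> (I \<circ> pair_perm \<rho>) * eps_prod k r \<eta> (J \<circ> \<rho>) else 0)"
    by (cases "I \<in> multi_indices (2 * r) n \<and> J \<in> multi_indices r k")
      (simp_all only: if_True if_False sum.neutral_const simp_thms)
  finally show ?thesis
    unfolding sym_elem_def symmetrize_def tensor_prod_def prod.case
    by (simp only: if_distrib[of "\<lambda>a. a / fact r"] div_0)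
qed

lemma finite_perm_pairs: "finite (perm_pairs r)"
  unfolding perm_pairs_def by (intro finite_cartesian_product finite_permutations) auto

lemma mem_perm_pairs: "(\<sigma>, \<eta>) \<in> perm_pairs r \<longleftrightarrow> \<sigma> permutes {1..2 * r} \<and> \<eta> permutes {1..r}"
  by (simp add: perm_pairs_def)

lemma formal_value_apply: "formal_value n k r c IJ = (\<Sum>p\<in>perm_pairs r. c p * sym_elem n k r p IJ)"
  by (simp add: formal_value_def sum_fun_apply scl_def)

lemma linear_formal_value: "Vector_Spaces.linear scl scl (formal_value n k r)"
  by unfold_locales
    (auto simp: fun_eq_iff formal_value_apply scl_def algebra_simps sum.distrib sum_distrib_left)

lemma formal_value_unit_fun:
  "p \<in> perm_pairs r \<Longrightarrow> formal_value n k r (unit_fun p) = sym_elem n k r p"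
  by (rule ext) (simp add: formal_value_apply unit_fun_def finite_perm_pairs if_distrib[of "\<lambda>a. a * _"] sum.delta' cong: if_cong)

lemma sym_elem_same_blocks:
  assumes "\<sigma> permutes {1..2 * r}" "\<tau> permutes {1..2 * r}" "same_blocks n (2 * r) \<sigma> \<tau>"
  shows "sym_elem n k r (\<sigma>, \<eta>) = scl ((-1) ^ odd_blocks n (2 * r) \<sigma> \<tau>) (sym_elem n k r (\<tau>, \<eta>))"
  using block_alternatingD[OF block_alternating_eps_prod assms]
  by (auto simp: fun_eq_iff sym_elem_apply scl_def sum_distrib_left mult.assoc)

lemma sym_elem_same_blocks_dual:
  assumes "\<eta> permutes {1..r}" "\<theta> permutes {1..r}" "same_blocks k r \<eta> \<theta>"
  shows "sym_elem n k r (\<sigma>, \<eta>) = scl ((-1) ^ odd_blocks k r \<eta> \<theta>) (sym_elem n k r (\<sigma>, \<theta>))"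
  using block_alternatingD[OF block_alternating_eps_prod assms]
  by (auto simp: fun_eq_iff sym_elem_apply scl_def sum_distrib_left mult_ac)

text \<open>
  Composing with \<open>\<rho>\<close> on the side of the elements is compensated by the substitution \<open>\<pi> \<mapsto> \<pi> \<circ> \<rho>\<close> in
  the symmetrizing sum.
\<close>

lemma sym_elem_reorder:
  assumes "\<sigma> permutes {1..2 * r}" "\<eta> permutes {1..r}" "\<rho> permutes {1..r}"
  shows "sym_elem n k r (\<sigma> \<circ> pair_perm \<rho>, \<eta> \<circ> \<rho>) = sym_elem n k r (\<sigma>, \<eta>)"
proof -
  have "(\<Sum>\<pi> | \<pi> permutes {1..r}.
          eps_prod n (2 * r) (\<sigma> \<circ> pair_perm \<rho>) (I \<circ> pair_perm \<pi>) * eps_prod k r (\<eta> \<circ> \<rho>) (J \<circ> \<pi>))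
      = (\<Sum>\<pi> | \<pi> permutes {1..r}. eps_prod n (2 * r) \<sigma> (I \<circ> pair_perm \<pi>) * eps_prod k r \<eta> (J \<circ> \<pi>))" for I J
    by (subst sum_permutations_compose_right[OF assms(3)])
      (simp add: pair_perm_compose[OF assms(3)] o_assoc eps_prod_compose_right[OF assms(3,2)]
        eps_prod_compose_right[OF pair_perm_permutes[OF assms(3)] assms(1)])
  then show ?thesis by (auto simp: fun_eq_iff sym_elem_apply)
qed

lemma sum_sym_elem_exchange:
  assumes m: "n > 0" "n dvd 2 * r" and s: "\<sigma> permutes {1..2 * r}"
    and z: "z \<in> {1..2 * r}" "(z - 1) div n \<noteq> b" and b: "b < 2 * r div n"
  shows "(\<Sum>j=1..n + 1. scl ((-1) ^ (j + 1)) (sym_elem n k r (exchange (n + 1) \<sigma> (block_and_point n b z \<sigma>) j, \<eta>))) = 0"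
    (is "sum ?f _ = 0")
proof
  fix IJ :: "(nat \<Rightarrow> nat) \<times> (nat \<Rightarrow> nat)"
  obtain I J where IJ: "IJ = (I, J)" by fastforce
  let ?e = "\<lambda>j. exchange (n + 1) \<sigma> (block_and_point n b z \<sigma>) j"
  have zero: "(\<Sum>j=1..n + 1. (-1) ^ (j + 1) * eps_prod n (2 * r) (?e j) I') = 0"
    if "I' \<in> multi_indices (2 * r) n" for I'
    unfolding sum_exchange_block_and_point[OF m block_alternating_eps_prod s z b]
    using block_exchange_eps_prod[OF m that] s z b unfolding block_exchange_def by simp
  show "sum ?f {1..n + 1} IJ = 0 IJ"
  proof (cases "I \<in> multi_indices (2 * r) n \<and> J \<in> multi_indices r k")
    case True
    have "sum ?f {1..n + 1} IJ = (\<Sum>j=1..n + 1. \<Sum>\<rho> | \<rho> permutes {1..r}.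
        (-1) ^ (j + 1) * eps_prod n (2 * r) (?e j) (I \<circ> pair_perm \<rho>) * (eps_prod k r \<eta> (J \<circ> \<rho>) / fact r))"
      unfolding sum_fun_apply IJ scl_def sym_elem_apply using True
      by (intro sum.cong refl) (simp add: sum_distrib_left sum_divide_distrib mult.assoc)
    also have "\<dots> = (\<Sum>\<rho> | \<rho> permutes {1..r}. \<Sum>j=1..n + 1.
        (-1) ^ (j + 1) * eps_prod n (2 * r) (?e j) (I \<circ> pair_perm \<rho>) * (eps_prod k r \<eta> (J \<circ> \<rho>) / fact r))"
      by (rule sum.swap)
    also have "\<dots> = 0"
    proof (rule sum.neutral, rule ballI)
      fix \<rho> assume "\<rho> \<in> {\<rho>. \<rho> permutes {1..r}}"
      then have "I \<circ> pair_perm \<rho> \<in> multi_indices (2 * r) n"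
        using True multi_indices_compose[OF pair_perm_permutes] by simp
      from zero[OF this] show "(\<Sum>j=1..n + 1. (-1) ^ (j + 1) * eps_prod n (2 * r) (?e j) (I \<circ> pair_perm \<rho>) *
          (eps_prod k r \<eta> (J \<circ> \<rho>) / fact r)) = 0"
        unfolding sum_distrib_right[symmetric] by (simp only: mult_zero_left)
    qed
    finally show ?thesis by simp
  next
    case False
    show ?thesis
      unfolding sum_fun_apply IJ scl_def sym_elem_apply if_not_P[OF False]
      by (simp only: mult_zero_right sum.neutral_const zero_fun_apply)
  qed
qed

lemma sum_sym_elem_exchange_dual:
  assumes m: "k > 0" "k dvd r" and s: "\<eta> permutes {1..r}"
    and z: "z \<in> {1..r}" "(z - 1) div k \<noteq> b" and b: "b < r div k"
  shows "(\<Sum>j=1..k + 1. scl ((-1) ^ j) (sym_elem n k r (\<sigma>, exchange (k + 1) \<eta> (block_and_point k b z \<eta>) j))) = 0"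
    (is "sum ?f _ = 0")
proof
  fix IJ :: "(nat \<Rightarrow> nat) \<times> (nat \<Rightarrow> nat)"
  obtain I J where IJ: "IJ = (I, J)" by fastforce
  let ?e = "\<lambda>j. exchange (k + 1) \<eta> (block_and_point k b z \<eta>) j"
  have "(\<Sum>j=1..k + 1. (-1) ^ (j + 1) * eps_prod k r (?e j) J') = 0"
    if "J' \<in> multi_indices r k" for J'
    unfolding sum_exchange_block_and_point[OF m block_alternating_eps_prod s z b]
    using block_exchange_eps_prod[OF m that] s z b unfolding block_exchange_def by simp
  then have zero: "(\<Sum>j=1..k + 1. (-1) ^ j * eps_prod k r (?e j) J') = 0"
    if "J' \<in> multi_indices r k" for J'
    using that by (simp only: power_add power_one_right mult_minus1_right mult_minus_left sum_negf neg_equal_0_iff_equal)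
  show "sum ?f {1..k + 1} IJ = 0 IJ"
  proof (cases "I \<in> multi_indices (2 * r) n \<and> J \<in> multi_indices r k")
    case True
    have "sum ?f {1..k + 1} IJ = (\<Sum>j=1..k + 1. \<Sum>\<rho> | \<rho> permutes {1..r}.
        (-1) ^ j * eps_prod k r (?e j) (J \<circ> \<rho>) * (eps_prod n (2 * r) \<sigma> (I \<circ> pair_perm \<rho>) / fact r))"
      unfolding sum_fun_apply IJ scl_def sym_elem_apply using True
      by (intro sum.cong refl) (simp add: sum_distrib_left sum_divide_distrib mult_ac)
    also have "\<dots> = (\<Sum>\<rho> | \<rho> permutes {1..r}. \<Sum>j=1..k + 1.
        (-1) ^ j * eps_prod k r (?e j) (J \<circ> \<rho>) * (eps_prod n (2 * r) \<sigma> (I \<circ> pair_perm \<rho>) / fact r))"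
      by (rule sum.swap)
    also have "\<dots> = 0"
    proof (rule sum.neutral, rule ballI)
      fix \<rho> assume "\<rho> \<in> {\<rho>. \<rho> permutes {1..r}}"
      then have "J \<circ> \<rho> \<in> multi_indices r k"
        using True multi_indices_compose by simp
      from zero[OF this] show "(\<Sum>j=1..k + 1. (-1) ^ j * eps_prod k r (?e j) (J \<circ> \<rho>) *
          (eps_prod n (2 * r) \<sigma> (I \<circ> pair_perm \<rho>) / fact r)) = 0"
        unfolding sum_distrib_right[symmetric] by (simp only: mult_zero_left)
    qed
    finally show ?thesis by simp
  next
    case False
    show ?thesis
      unfolding sum_fun_apply IJ scl_def sym_elem_apply if_not_P[OF False]
      by (simp only: mult_zero_right sum.neutral_const zero_fun_apply)
  qed
qed

section \<open>All relations come from the generators\<close>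

text \<open>
  The separating functional \<open>\<phi>\<close> gives a function \<open>c\<close> of two permutations to which the reconstruction
  formula applies in each variable. The reordering invariance of \<open>c\<close> makes room for the average over
  \<open>\<rho>\<close>, which turns products of permutation symbols into coordinates of \<open>sym_elem\<close>.
\<close>

lemma relation_in_span:
  assumes n: "n > 0" "n dvd 2 * r" and k: "k > 0" "k dvd r"
    and supp: "\<And>p. p \<notin> perm_pairs r \<Longrightarrow> x p = 0" and x: "formal_value n k r x = 0"
  shows "x \<in> cfun.span (trivial_relations n k r \<union> reorderings r \<union> exchange_relations n k r)"
proof (rule ccontr)
  let ?G = "trivial_relations n k r \<union> reorderings r \<union> exchange_relations n k r"
  assume "x \<notin> cfun.span ?G"
  then obtain \<phi> where lin: "Vector_Spaces.linear scl (*) \<phi>"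
    and G: "\<And>g. g \<in> ?G \<Longrightarrow> \<phi> g = 0" and one: "\<phi> x = 1"
    by (rule separating_functional) blast
  interpret L: Vector_Spaces.linear scl "(*)" \<phi> by (rule lin)
  interpret V: Vector_Spaces.linear scl scl "formal_value n k r" by (rule linear_formal_value)
  define c where "c \<sigma> \<eta> = \<phi> (unit_fun (\<sigma>, \<eta>))" for \<sigma> \<eta>
  have alt_V: "block_alternating n (2 * r) (\<lambda>\<sigma>. c \<sigma> \<eta>)" if \<eta>: "\<eta> permutes {1..r}" for \<eta>
    unfolding block_alternating_def
  proof (intro allI impI)
    fix \<sigma> \<tau> assume "\<sigma> permutes {1..2 * r}" "\<tau> permutes {1..2 * r}" "same_blocks n (2 * r) \<sigma> \<tau>"
    then have "unit_fun (\<sigma>, \<eta>) - scl ((-1) ^ odd_blocks n (2 * r) \<sigma> \<tau>) (unit_fun (\<tau>, \<eta>)) \<in> ?G"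
      using \<eta> unfolding trivial_relations_def mem_perm_pairs by blast
    from G[OF this] show "c \<sigma> \<eta> = (-1) ^ odd_blocks n (2 * r) \<sigma> \<tau> * c \<tau> \<eta>"
      by (simp add: L.diff L.scale c_def)
  qed
  have alt_W: "block_alternating k r (c \<sigma>)" if \<sigma>: "\<sigma> permutes {1..2 * r}" for \<sigma>
    unfolding block_alternating_def
  proof (intro allI impI)
    fix \<eta> \<theta> assume "\<eta> permutes {1..r}" "\<theta> permutes {1..r}" "same_blocks k r \<eta> \<theta>"
    then have "unit_fun (\<sigma>, \<eta>) - scl ((-1) ^ odd_blocks k r \<eta> \<theta>) (unit_fun (\<sigma>, \<theta>)) \<in> ?G"
      using \<sigma> unfolding trivial_relations_def mem_perm_pairs by blast
    from G[OF this] show "c \<sigma> \<eta> = (-1) ^ odd_blocks k r \<eta> \<theta> * c \<sigma> \<theta>"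
      by (simp add: L.diff L.scale c_def)
  qed
  have exch_V: "block_exchange n (2 * r) (\<lambda>\<sigma>. c \<sigma> \<eta>)" if \<eta>: "\<eta> permutes {1..r}" for \<eta>
    unfolding block_exchange_def
  proof (intro allI impI)
    fix \<sigma> z b assume s: "\<sigma> permutes {1..2 * r}" and z: "z \<in> {1..2 * r}" and b: "b < 2 * r div n"
      and zb: "(z - 1) div n \<noteq> b"
    let ?e = "exchange (n + 1) \<sigma> (block_and_point n b z \<sigma>)"
    let ?g = "\<Sum>j=1..n + 1. scl ((-1) ^ (j + 1)) (unit_fun (?e j, \<eta>))"
    note i = block_and_point_props[OF n s z zb b]
    have "formal_value n k r ?g = (\<Sum>j=1..n + 1. scl ((-1) ^ (j + 1)) (sym_elem n k r (?e j, \<eta>)))"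
      unfolding V.sum V.scale
      by (intro sum.cong refl arg_cong2[of _ _ _ _ scl] formal_value_unit_fun)
        (simp only: mem_perm_pairs exchange_permutes[OF s i] \<eta>)
    also have "\<dots> = 0" by (rule sum_sym_elem_exchange[OF n s z zb b])
    finally have "?g \<in> ?G"
      using s \<eta> i unfolding exchange_relations_def exchange_V_def mem_perm_pairs by blast
    from G[OF this] have "(\<Sum>j=1..n + 1. (-1) ^ (j + 1) * c (?e j) \<eta>) = 0"
      unfolding L.sum L.scale c_def .
    then have "(-1) ^ n * (c \<sigma> \<eta> - (\<Sum>y | y \<in> {1..2 * r} \<and> (y - 1) div n = b. c (transpose z y \<circ> \<sigma>) \<eta>)) = 0"
      unfolding sum_exchange_block_and_point[OF n alt_V[OF \<eta>] s z zb b] .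
    then show "(\<Sum>y | y \<in> {1..2 * r} \<and> (y - 1) div n = b. c (transpose z y \<circ> \<sigma>) \<eta>) = c \<sigma> \<eta>" by simp
  qed
  have exch_W: "block_exchange k r (c \<sigma>)" if \<sigma>: "\<sigma> permutes {1..2 * r}" for \<sigma>
    unfolding block_exchange_def
  proof (intro allI impI)
    fix \<eta> z b assume s: "\<eta> permutes {1..r}" and z: "z \<in> {1..r}" and b: "b < r div k"
      and zb: "(z - 1) div k \<noteq> b"
    let ?e = "exchange (k + 1) \<eta> (block_and_point k b z \<eta>)"
    let ?g = "\<Sum>j=1..k + 1. scl ((-1) ^ j) (unit_fun (\<sigma>, ?e j))"
    note i = block_and_point_props[OF k s z zb b]
    have "formal_value n k r ?g = (\<Sum>j=1..k + 1. scl ((-1) ^ j) (sym_elem n k r (\<sigma>, ?e j)))"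
      unfolding V.sum V.scale
      by (intro sum.cong refl arg_cong2[of _ _ _ _ scl] formal_value_unit_fun)
        (simp only: mem_perm_pairs exchange_permutes[OF s i] \<sigma>)
    also have "\<dots> = 0" by (rule sum_sym_elem_exchange_dual[OF k s z zb b])
    finally have "?g \<in> ?G"
      using s \<sigma> i unfolding exchange_relations_def exchange_W_def mem_perm_pairs by blast
    from G[OF this] have "(\<Sum>j=1..k + 1. (-1) ^ j * c \<sigma> (?e j)) = 0"
      unfolding L.sum L.scale c_def .
    then have "(\<Sum>j=1..k + 1. (-1) ^ (j + 1) * c \<sigma> (?e j)) = 0"
      by (simp only: power_add power_one_right mult_minus1_right mult_minus_left sum_negf neg_equal_0_iff_equal)
    then have "(-1) ^ k * (c \<sigma> \<eta> - (\<Sum>y | y \<in> {1..r} \<and> (y - 1) div k = b. c \<sigma> (transpose z y \<circ> \<eta>))) = 0"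
      unfolding sum_exchange_block_and_point[OF k alt_W[OF \<sigma>] s z zb b] .
    then show "(\<Sum>y | y \<in> {1..r} \<and> (y - 1) div k = b. c \<sigma> (transpose z y \<circ> \<eta>)) = c \<sigma> \<eta>" by simp
  qed
  have reorder: "c (\<sigma> \<circ> pair_perm \<rho>) (\<eta> \<circ> \<rho>) = c \<sigma> \<eta>"
    if "\<sigma> permutes {1..2 * r}" "\<eta> permutes {1..r}" "\<rho> permutes {1..r}" for \<sigma> \<eta> \<rho>
  proof -
    have "unit_fun (\<sigma>, \<eta>) - unit_fun (\<sigma> \<circ> pair_perm \<rho>, \<eta> \<circ> \<rho>) \<in> ?G"
      using that unfolding reorderings_def mem_perm_pairs by blast
    from G[OF this] show ?thesis by (simp add: L.diff c_def)
  qed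
  let ?P = "{\<tau>. \<tau> permutes {1..2 * r}}" and ?Q = "{\<theta>. \<theta> permutes {1..r}}"
  let ?R = "standard_label n (2 * r)" and ?S = "standard_label k r"
  let ?H = "block_factor n (2 * r) * block_factor k r"
  have reconstruct: "?H * c \<sigma> \<eta>
      = (\<Sum>(\<tau>, \<theta>)\<in>perm_pairs r. c \<tau> \<theta> * sym_elem n k r (\<sigma>, \<eta>) (?R \<circ> \<tau>, ?S \<circ> \<theta>))"
    if \<sigma>: "\<sigma> permutes {1..2 * r}" and \<eta>: "\<eta> permutes {1..r}" for \<sigma> \<eta>
  proof -
    let ?e = "eps_prod n (2 * r) \<sigma>" and ?d = "eps_prod k r \<eta>"
    have "?H * c \<sigma> \<eta> = (\<Sum>\<tau>\<in>?P. ?e (?R \<circ> \<tau>) * (block_factor k r * c \<tau> \<eta>))"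
    proof -
      have "?H * c \<sigma> \<eta> = block_factor k r * (block_factor n (2 * r) * c \<sigma> \<eta>)"
        by (simp only: mult_ac)
      also have "\<dots> = (\<Sum>\<tau>\<in>?P. block_factor k r * (?e (?R \<circ> \<tau>) * c \<tau> \<eta>))"
        unfolding block_exchange_reconstruction[OF n alt_V[OF \<eta>] exch_V[OF \<eta>] \<sigma>]
        by (rule sum_distrib_left)
      finally show ?thesis by (simp only: mult.left_commute)
    qed
    also have "\<dots> = (\<Sum>\<tau>\<in>?P. ?e (?R \<circ> \<tau>) * (\<Sum>\<theta>\<in>?Q. ?d (?S \<circ> \<theta>) * c \<tau> \<theta>))"
    proof (rule sum.cong[OF refl])
      fix \<tau> assume "\<tau> \<in> ?P"
      then have \<tau>: "\<tau> permutes {1..2 * r}" by simp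
      show "?e (?R \<circ> \<tau>) * (block_factor k r * c \<tau> \<eta>) = ?e (?R \<circ> \<tau>) * (\<Sum>\<theta>\<in>?Q. ?d (?S \<circ> \<theta>) * c \<tau> \<theta>)"
        by (simp only: block_exchange_reconstruction[OF k alt_W[OF \<tau>] exch_W[OF \<tau>] \<eta>])
    qed
    also have "\<dots> = (\<Sum>\<tau>\<in>?P. \<Sum>\<theta>\<in>?Q. ?e (?R \<circ> \<tau>) * ?d (?S \<circ> \<theta>) * c \<tau> \<theta>)"
      by (rule sum.cong[OF refl]) (simp only: sum_distrib_left mult.assoc)
    finally have base: "?H * c \<sigma> \<eta> = (\<Sum>\<tau>\<in>?P. \<Sum>\<theta>\<in>?Q. ?e (?R \<circ> \<tau>) * ?d (?S \<circ> \<theta>) * c \<tau> \<theta>)" .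
    \<comment> \<open>shift both summation variables by \<open>\<rho>\<close>; the values of \<open>c\<close> do not change\<close>
    have shifted: "?H * c \<sigma> \<eta>
        = (\<Sum>\<tau>\<in>?P. \<Sum>\<theta>\<in>?Q. ?e (?R \<circ> \<tau> \<circ> pair_perm \<rho>) * ?d (?S \<circ> \<theta> \<circ> \<rho>) * c \<tau> \<theta>)"
      if \<rho>: "\<rho> \<in> ?Q" for \<rho>
    proof -
      have \<rho>: "\<rho> permutes {1..r}" using that by simp
      have "?H * c \<sigma> \<eta> = (\<Sum>\<tau>\<in>?P. \<Sum>\<theta>\<in>?Q. ?e (?R \<circ> (\<tau> \<circ> pair_perm \<rho>)) * ?d (?S \<circ> \<theta>) * c (\<tau> \<circ> pair_perm \<rho>) \<theta>)"
        unfolding base by (rule sum_permutations_compose_right[OF pair_perm_permutes[OF \<rho>]])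
      also have "\<dots> = (\<Sum>\<tau>\<in>?P. \<Sum>\<theta>\<in>?Q. ?e (?R \<circ> (\<tau> \<circ> pair_perm \<rho>)) * ?d (?S \<circ> (\<theta> \<circ> \<rho>)) *
            c (\<tau> \<circ> pair_perm \<rho>) (\<theta> \<circ> \<rho>))"
        by (rule sum.cong[OF refl], rule sum_permutations_compose_right[OF \<rho>])
      also have "\<dots> = (\<Sum>\<tau>\<in>?P. \<Sum>\<theta>\<in>?Q. ?e (?R \<circ> \<tau> \<circ> pair_perm \<rho>) * ?d (?S \<circ> \<theta> \<circ> \<rho>) * c \<tau> \<theta>)"
        by (intro sum.cong refl) (simp add: reorder[OF _ _ \<rho>] o_assoc)
      finally show ?thesis .
    qed
    have "card ?Q = fact r" by (rule card_permutations) simp_all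
    then have "fact r * (?H * c \<sigma> \<eta>) = (\<Sum>\<rho>\<in>?Q. ?H * c \<sigma> \<eta>)"
      by (simp only: sum_constant of_nat_fact)
    also have "\<dots> = (\<Sum>\<rho>\<in>?Q. \<Sum>\<tau>\<in>?P. \<Sum>\<theta>\<in>?Q. ?e (?R \<circ> \<tau> \<circ> pair_perm \<rho>) * ?d (?S \<circ> \<theta> \<circ> \<rho>) * c \<tau> \<theta>)"
      by (rule sum.cong[OF refl shifted])
    also have "\<dots> = (\<Sum>\<tau>\<in>?P. \<Sum>\<rho>\<in>?Q. \<Sum>\<theta>\<in>?Q. ?e (?R \<circ> \<tau> \<circ> pair_perm \<rho>) * ?d (?S \<circ> \<theta> \<circ> \<rho>) * c \<tau> \<theta>)"
      by (rule sum.swap)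
    also have "\<dots> = (\<Sum>\<tau>\<in>?P. \<Sum>\<theta>\<in>?Q. \<Sum>\<rho>\<in>?Q. ?e (?R \<circ> \<tau> \<circ> pair_perm \<rho>) * ?d (?S \<circ> \<theta> \<circ> \<rho>) * c \<tau> \<theta>)"
      by (rule sum.cong[OF refl], rule sum.swap)
    also have "\<dots> = (\<Sum>\<tau>\<in>?P. \<Sum>\<theta>\<in>?Q. fact r * (c \<tau> \<theta> * sym_elem n k r (\<sigma>, \<eta>) (?R \<circ> \<tau>, ?S \<circ> \<theta>)))"
    proof (rule sum.cong[OF refl], rule sum.cong[OF refl])
      fix \<tau> \<theta> assume "\<tau> \<in> ?P" "\<theta> \<in> ?Q"
      then have "?R \<circ> \<tau> \<in> multi_indices (2 * r) n" "?S \<circ> \<theta> \<in> multi_indices r k"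
        using standard_label_compose_multi_index n(1) k(1) by auto
      then have eps_sum: "(\<Sum>\<rho>\<in>?Q. ?e (?R \<circ> \<tau> \<circ> pair_perm \<rho>) * ?d (?S \<circ> \<theta> \<circ> \<rho>))
          = fact r * sym_elem n k r (\<sigma>, \<eta>) (?R \<circ> \<tau>, ?S \<circ> \<theta>)"
        by (simp add: sym_elem_apply)
      have "(\<Sum>\<rho>\<in>?Q. ?e (?R \<circ> \<tau> \<circ> pair_perm \<rho>) * ?d (?S \<circ> \<theta> \<circ> \<rho>) * c \<tau> \<theta>)
          = (\<Sum>\<rho>\<in>?Q. ?e (?R \<circ> \<tau> \<circ> pair_perm \<rho>) * ?d (?S \<circ> \<theta> \<circ> \<rho>)) * c \<tau> \<theta>"
        by (rule sum_distrib_right[symmetric])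
      then show "(\<Sum>\<rho>\<in>?Q. ?e (?R \<circ> \<tau> \<circ> pair_perm \<rho>) * ?d (?S \<circ> \<theta> \<circ> \<rho>) * c \<tau> \<theta>)
          = fact r * (c \<tau> \<theta> * sym_elem n k r (\<sigma>, \<eta>) (?R \<circ> \<tau>, ?S \<circ> \<theta>))"
        unfolding eps_sum by (simp only: mult_ac)
    qed
    also have "\<dots> = fact r * (\<Sum>\<tau>\<in>?P. \<Sum>\<theta>\<in>?Q. c \<tau> \<theta> * sym_elem n k r (\<sigma>, \<eta>) (?R \<circ> \<tau>, ?S \<circ> \<theta>))"
      by (simp only: sum_distrib_left)
    finally show ?thesis by (simp add: perm_pairs_def sum.cartesian_product)
  qed
  have expand: "x = (\<Sum>p\<in>perm_pairs r. scl (x p) (unit_fun p))"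
    by (rule ext)
      (use supp in \<open>auto simp: sum_fun_apply scl_def unit_fun_def finite_perm_pairs if_distrib[of "(*) _"]
        sum.delta cong: if_cong\<close>)
  have "\<phi> x = (\<Sum>p\<in>perm_pairs r. x p * \<phi> (unit_fun p))"
    by (subst expand) (simp only: L.sum L.scale)
  then have "?H * \<phi> x = (\<Sum>p\<in>perm_pairs r. x p * (?H * \<phi> (unit_fun p)))"
    by (simp only: sum_distrib_left mult_ac)
  also have "\<dots> = (\<Sum>p\<in>perm_pairs r. \<Sum>q\<in>perm_pairs r.
      case_prod c q * (x p * sym_elem n k r p (?R \<circ> fst q, ?S \<circ> snd q)))"
  proof (rule sum.cong[OF refl])
    fix p assume "p \<in> perm_pairs r"
    then obtain \<sigma> \<eta> where p: "p = (\<sigma>, \<eta>)" "\<sigma> permutes {1..2 * r}" "\<eta> permutes {1..r}"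
      by (cases p) (auto simp: mem_perm_pairs)
    have "\<phi> (unit_fun p) = c \<sigma> \<eta>" by (simp only: p(1) c_def)
    then have "x p * (?H * \<phi> (unit_fun p)) = x p * (\<Sum>q\<in>perm_pairs r.
        case_prod c q * sym_elem n k r p (?R \<circ> fst q, ?S \<circ> snd q))"
      by (simp only: reconstruct[OF p(2,3)] p(1) case_prod_unfold)
    then show "x p * (?H * \<phi> (unit_fun p))
        = (\<Sum>q\<in>perm_pairs r. case_prod c q * (x p * sym_elem n k r p (?R \<circ> fst q, ?S \<circ> snd q)))"
      by (simp only: sum_distrib_left mult.left_commute)
  qed
  also have "\<dots> = (\<Sum>q\<in>perm_pairs r. \<Sum>p\<in>perm_pairs r.
      case_prod c q * (x p * sym_elem n k r p (?R \<circ> fst q, ?S \<circ> snd q)))"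
    by (rule sum.swap)
  also have "\<dots> = (\<Sum>q\<in>perm_pairs r. case_prod c q * formal_value n k r x (?R \<circ> fst q, ?S \<circ> snd q))"
    by (simp only: formal_value_apply sum_distrib_left)
  also have "\<dots> = 0" by (simp add: x)
  finally show False using one block_factor_nonzero by simp
qed

lemma formal_value_generator:
  assumes "g \<in> trivial_relations n k r \<union> reorderings r \<union> exchange_relations n k r"
  shows "formal_value n k r g = 0"
proof -
  interpret V: Vector_Spaces.linear scl scl "formal_value n k r" by (rule linear_formal_value)
  from assms consider "g \<in> trivial_relations n k r" | "g \<in> reorderings r" | "g \<in> exchange_relations n k r"
    by blast
  then show ?thesis
  proof cases
    case 1
    then show ?thesis
      unfolding trivial_relations_def
      by (auto simp: V.diff V.scale formal_value_unit_fun mem_perm_pairs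
          sym_elem_same_blocks sym_elem_same_blocks_dual)
  next
    case 2
    then obtain \<sigma> \<eta> \<rho> where g: "g = unit_fun (\<sigma>, \<eta>) - unit_fun (\<sigma> \<circ> pair_perm \<rho>, \<eta> \<circ> \<rho>)"
      and p: "\<sigma> permutes {1..2 * r}" "\<eta> permutes {1..r}" "\<rho> permutes {1..r}"
      unfolding reorderings_def mem_perm_pairs by blast
    show ?thesis
      using p permutes_compose[OF pair_perm_permutes p(1)] permutes_compose[OF p(3,2)]
      by (simp add: g V.diff formal_value_unit_fun mem_perm_pairs sym_elem_reorder)
  qed (simp add: exchange_relations_def)
qed

lemma generator_support:
  assumes "g \<in> trivial_relations n k r \<union> reorderings r \<union> exchange_relations n k r"
    and "p \<notin> perm_pairs r"
  shows "g p = 0"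
proof -
  have unit: "unit_fun q p = 0" if "q \<in> perm_pairs r" for q
    using that assms(2) by (auto simp: unit_fun_def)
  from assms consider "g \<in> trivial_relations n k r" | "g \<in> reorderings r"
    | "g \<in> exchange_V n r" | "g \<in> exchange_W k r"
    unfolding exchange_relations_def by blast
  then show ?thesis
  proof cases
    case 1
    then show ?thesis
      unfolding trivial_relations_def by (auto simp: scl_def unit)
  next
    case 2
    then obtain \<sigma> \<eta> \<rho> where g: "g = unit_fun (\<sigma>, \<eta>) - unit_fun (\<sigma> \<circ> pair_perm \<rho>, \<eta> \<circ> \<rho>)"
      and p: "\<sigma> permutes {1..2 * r}" "\<eta> permutes {1..r}" "\<rho> permutes {1..r}"
      unfolding reorderings_def mem_perm_pairs by blast
    show ?thesis
      using p permutes_compose[OF pair_perm_permutes p(1)] permutes_compose[OF p(3,2)]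
      by (simp add: g unit mem_perm_pairs)
  next
    case 3
    then obtain \<sigma> \<eta> i where g: "g = (\<Sum>j=1..n+1. scl ((-1) ^ (j + 1)) (unit_fun (exchange (n + 1) \<sigma> i j, \<eta>)))"
      and s: "\<sigma> permutes {1..2 * r}" "\<eta> permutes {1..r}" "inj_on i {1..n+1}" "i ` {1..n+1} \<subseteq> {1..2 * r}"
      unfolding exchange_V_def mem_perm_pairs by blast
    show ?thesis
      unfolding g sum_fun_apply
    proof (rule sum.neutral, rule ballI)
      fix j assume "j \<in> {1..n + 1}"
      then have "(exchange (n + 1) \<sigma> i j, \<eta>) \<in> perm_pairs r"
        unfolding mem_perm_pairs using exchange_permutes[OF s(1,3,4)] s(2) by blast
      then show "scl ((-1) ^ (j + 1)) (unit_fun (exchange (n + 1) \<sigma> i j, \<eta>)) p = 0"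
        by (simp add: scl_def unit)
    qed
  next
    case 4
    then obtain \<sigma> \<eta> i where g: "g = (\<Sum>j=1..k+1. scl ((-1) ^ j) (unit_fun (\<sigma>, exchange (k + 1) \<eta> i j)))"
      and s: "\<eta> permutes {1..r}" "\<sigma> permutes {1..2 * r}" "inj_on i {1..k+1}" "i ` {1..k+1} \<subseteq> {1..r}"
      unfolding exchange_W_def mem_perm_pairs by blast
    show ?thesis
      unfolding g sum_fun_apply
    proof (rule sum.neutral, rule ballI)
      fix j assume "j \<in> {1..k + 1}"
      then have "(\<sigma>, exchange (k + 1) \<eta> i j) \<in> perm_pairs r"
        unfolding mem_perm_pairs using exchange_permutes[OF s(1,3,4)] s(2) by blast
      then show "scl ((-1) ^ j) (unit_fun (\<sigma>, exchange (k + 1) \<eta> i j)) p = 0"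
        by (simp add: scl_def unit)
    qed
  qed
qed

lemma linear_on_nonzero: "Vector_Spaces.linear scl scl (on_nonzero n k r)"
  by unfold_locales (auto simp: fun_eq_iff on_nonzero_def scl_def)

lemma linear_on_elems: "Vector_Spaces.linear scl scl (on_elems n k r)"
  by unfold_locales
    (auto simp: fun_eq_iff on_elems_def sum_fun_apply scl_def algebra_simps sum.distrib sum_distrib_left)

lemma formal_value_on_nonzero: "formal_value n k r (on_nonzero n k r c) = formal_value n k r c"
  by (rule ext, unfold formal_value_apply, intro sum.cong refl) (simp add: on_nonzero_def)

lemma on_elems_apply:
  "on_elems n k r c y = (\<Sum>p | p \<in> perm_pairs r \<and> sym_elem n k r p \<noteq> 0 \<and> sym_elem n k r p = y. c p)"
proof -
  have "on_elems n k r c y = (\<Sum>p\<in>{p \<in> perm_pairs r. sym_elem n k r p \<noteq> 0}. if sym_elem n k r p = y then c p else 0)"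
    unfolding on_elems_def sum_fun_apply by (intro sum.cong refl) (auto simp: scl_def unit_fun_def)
  also have "\<dots> = sum c {p \<in> {p \<in> perm_pairs r. sym_elem n k r p \<noteq> 0}. sym_elem n k r p = y}"
    by (rule sum.inter_filter[symmetric]) (simp add: finite_perm_pairs)
  finally show ?thesis by (simp add: conj_assoc)
qed

lemma nonzero_elems_eq: "nonzero_elems n k r = sym_elem n k r ` {p \<in> perm_pairs r. sym_elem n k r p \<noteq> 0}"
  by (auto simp: nonzero_elems_def)

text \<open>
  Collecting the pairs by the element that they denote does not change the value.
\<close>

lemma sum_on_elems: "(\<Sum>y\<in>nonzero_elems n k r. scl (on_elems n k r c y) y) = formal_value n k r c"
proof -
  let ?s = "sym_elem n k r" and ?Q = "{p \<in> perm_pairs r. sym_elem n k r p \<noteq> 0}"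
  have fin: "finite ?Q" by (simp add: finite_perm_pairs)
  have "(\<Sum>y\<in>nonzero_elems n k r. scl (on_elems n k r c y) y)
      = (\<Sum>y\<in>?s ` ?Q. \<Sum>p | p \<in> ?Q \<and> ?s p = y. scl (c p) (?s p))"
    unfolding nonzero_elems_eq
    by (intro sum.cong refl) (simp add: on_elems_apply cfun.scale_sum_left conj_assoc)
  also have "\<dots> = (\<Sum>p\<in>?Q. scl (c p) (?s p))"
    by (rule sum.group) (use fin in auto)
  also have "\<dots> = formal_value n k r c"
    unfolding formal_value_def
    by (rule sum.mono_neutral_left) (auto simp: finite_perm_pairs)
  finally show ?thesis .
qed

lemma subspace_elem_relations: "cfun.subspace (elem_relations n k r)"
proof (rule cfun.subspaceI)
  have scl_apply: "scl a c y = a * c y" for a and c :: "'x \<Rightarrow> complex" and y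
    by (simp add: scl_def)
  show "0 \<in> elem_relations n k r" by (simp add: elem_relations_def)
  fix c assume c: "c \<in> elem_relations n k r"
  show "c + d \<in> elem_relations n k r" if "d \<in> elem_relations n k r" for d
    using c that by (simp add: elem_relations_def cfun.scale_left_distrib sum.distrib)
  show "scl a c \<in> elem_relations n k r" for a
  proof -
    have "(\<Sum>y\<in>nonzero_elems n k r. scl (scl a c y) y) = scl a (\<Sum>y\<in>nonzero_elems n k r. scl (c y) y)"
      by (simp add: scl_apply cfun.scale_sum_right)
    then show ?thesis using c by (simp add: elem_relations_def scl_apply)
  qed
qed

lemma subspace_indexed_relations: "cfun.subspace (indexed_relations n k r)"
proof -
  interpret V: Vector_Spaces.linear scl scl "formal_value n k r" by (rule linear_formal_value)
  show ?thesis
    by (auto simp: cfun.subspace_def indexed_relations_def V.add V.scale V.zero) (simp_all add: scl_def)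
qed

lemma indexed_relations_eq_span:
  assumes "n > 0" "n dvd 2 * r" "k > 0" "k dvd r"
  shows "indexed_relations n k r = cfun.span (on_nonzero n k r `
           (trivial_relations n k r \<union> reorderings r \<union> exchange_relations n k r))"
    (is "_ = cfun.span (_ ` ?G)")
proof
  interpret L: Vector_Spaces.linear scl scl "on_nonzero n k r" by (rule linear_on_nonzero)
  show "indexed_relations n k r \<subseteq> cfun.span (on_nonzero n k r ` ?G)"
  proof
    fix c assume c: "c \<in> indexed_relations n k r"
    then have "c \<in> cfun.span ?G"
      by (intro relation_in_span[OF assms]) (auto simp: indexed_relations_def)
    then have "on_nonzero n k r c \<in> cfun.span (on_nonzero n k r ` ?G)" unfolding L.span_image by blast
    moreover have "on_nonzero n k r c = c"
      using c by (auto simp: on_nonzero_def indexed_relations_def fun_eq_iff)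
    ultimately show "c \<in> cfun.span (on_nonzero n k r ` ?G)" by simp
  qed
  show "cfun.span (on_nonzero n k r ` ?G) \<subseteq> indexed_relations n k r"
  proof (rule cfun.span_minimal[OF _ subspace_indexed_relations], rule image_subsetI)
    fix g assume g: "g \<in> ?G"
    show "on_nonzero n k r g \<in> indexed_relations n k r"
      using formal_value_generator[OF g] generator_support[OF g] formal_value_on_nonzero[of n k r g]
      by (auto simp: indexed_relations_def on_nonzero_def)
  qed
qed

text \<open>
  A relation \<open>c\<close> among elements lifts to a formal combination \<open>d\<close> of pairs, and \<open>on_elems\<close> maps the
  generators that span \<open>d\<close> to generators for \<open>c\<close>. Reorderings become zero, because they identify
  symbols of the same element.
\<close>

lemma elem_relations_eq_span:
  assumes "n > 0" "n dvd 2 * r" "k > 0" "k dvd r"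
  shows "elem_relations n k r
           = cfun.span (on_elems n k r ` (trivial_relations n k r \<union> exchange_relations n k r))"
    (is "_ = cfun.span (_ ` ?G)")
proof
  interpret L: Vector_Spaces.linear scl scl "on_elems n k r" by (rule linear_on_elems)
  let ?s = "sym_elem n k r" and ?Q = "{p \<in> perm_pairs r. sym_elem n k r p \<noteq> 0}"
  have fin: "finite ?Q" by (simp add: finite_perm_pairs)
  show "elem_relations n k r \<subseteq> cfun.span (on_elems n k r ` ?G)"
  proof
    fix c assume c: "c \<in> elem_relations n k r"
    \<comment> \<open>spread \<open>c y\<close> evenly over the pairs that denote \<open>y\<close>\<close>
    define d where "d p = (if p \<in> ?Q then c (?s p) / of_nat (card {q \<in> ?Q. ?s q = ?s p}) else 0)" for p
    have d: "on_elems n k r d = c"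
    proof
      fix y
      have "on_elems n k r d y = (\<Sum>p | p \<in> ?Q \<and> ?s p = y. c y / of_nat (card {q \<in> ?Q. ?s q = y}))"
        unfolding on_elems_apply
      proof (rule sum.cong)
        fix p assume "p \<in> {p. p \<in> ?Q \<and> ?s p = y}"
        then have "p \<in> ?Q" "?s p = y" by auto
        then show "d p = c y / of_nat (card {q \<in> ?Q. ?s q = y})" by (simp only: d_def if_True)
      qed (simp only: mem_Collect_eq conj_assoc)
      also have "\<dots> = c y"
      proof (cases "y \<in> nonzero_elems n k r")
        case True
        then have "{q \<in> ?Q. ?s q = y} \<noteq> {}" unfolding nonzero_elems_eq by blast
        moreover have "finite {q \<in> ?Q. ?s q = y}" by (rule finite_subset[OF _ fin]) blast
        ultimately have "card {q \<in> ?Q. ?s q = y} \<noteq> 0" by (simp only: card_0_eq not_False_eq_True)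
        then have "of_nat (card {q \<in> ?Q. ?s q = y}) \<noteq> (0 :: complex)" by (simp only: of_nat_eq_0_iff not_False_eq_True)
        then show ?thesis by (simp only: sum_constant nonzero_mult_div_cancel_left times_divide_eq_right not_False_eq_True)
      next
        case False
        then have "{q \<in> ?Q. ?s q = y} = {}" unfolding nonzero_elems_eq by blast
        moreover have "c y = 0" using c False by (simp add: elem_relations_def)
        ultimately show ?thesis by (simp only: sum.empty)
      qed
      finally show "on_elems n k r d y = c y" .
    qed
    have "formal_value n k r d = 0"
      using c sum_on_elems[of n k r d] unfolding d by (simp add: elem_relations_def)
    then have "d \<in> cfun.span (trivial_relations n k r \<union> reorderings r \<union> exchange_relations n k r)"
      by (intro relation_in_span[OF assms]) (auto simp: d_def)
    then have "c \<in> cfun.span (on_elems n k r ` (trivial_relations n k r \<union> reorderings r \<union> exchange_relations n k r))"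
      unfolding L.span_image using d by blast
    moreover have "on_elems n k r ` (trivial_relations n k r \<union> reorderings r \<union> exchange_relations n k r)
        \<subseteq> cfun.span (on_elems n k r ` ?G)"
    proof (rule image_subsetI)
      fix g assume "g \<in> trivial_relations n k r \<union> reorderings r \<union> exchange_relations n k r"
      then consider "g \<in> ?G" | "g \<in> reorderings r" by blast
      then show "on_elems n k r g \<in> cfun.span (on_elems n k r ` ?G)"
      proof cases
        case 1
        then show ?thesis by (intro cfun.span_base imageI)
      next
        case 2
        then obtain \<sigma> \<eta> \<rho> where g: "g = unit_fun (\<sigma>, \<eta>) - unit_fun (\<sigma> \<circ> pair_perm \<rho>, \<eta> \<circ> \<rho>)"
          and p: "\<sigma> permutes {1..2 * r}" "\<eta> permutes {1..r}" "\<rho> permutes {1..r}"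
          unfolding reorderings_def mem_perm_pairs by blast
        have unit: "on_elems n k r (unit_fun q)
            = (if ?s q = 0 then 0 else unit_fun (?s q))" if "q \<in> perm_pairs r" for q
        proof -
          have "on_elems n k r (unit_fun q) = (\<Sum>p\<in>?Q. if p = q then unit_fun (?s p) else 0)"
            unfolding on_elems_def by (intro sum.cong refl) (auto simp: unit_fun_def scl_def fun_eq_iff)
          then show ?thesis using that fin by (simp add: sum.delta)
        qed
        have "on_elems n k r g = 0"
          using p permutes_compose[OF pair_perm_permutes p(1)] permutes_compose[OF p(3,2)]
          by (simp add: g L.diff unit mem_perm_pairs sym_elem_reorder)
        then show ?thesis by (simp add: cfun.span_zero)
      qed
    qed
    ultimately show "c \<in> cfun.span (on_elems n k r ` ?G)"
      using cfun.span_minimal[OF _ cfun.subspace_span] by blast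
  qed
  show "cfun.span (on_elems n k r ` ?G) \<subseteq> elem_relations n k r"
  proof (rule cfun.span_minimal[OF _ subspace_elem_relations], rule image_subsetI)
    fix g assume "g \<in> ?G"
    then have "formal_value n k r g = 0" by (intro formal_value_generator) blast
    moreover have "on_elems n k r g y = 0" if "y \<notin> nonzero_elems n k r" for y
      unfolding on_elems_apply using that by (intro sum.neutral) (auto simp: nonzero_elems_eq)
    ultimately show "on_elems n k r g \<in> elem_relations n k r"
      by (simp add: elem_relations_def sum_on_elems)
  qed
qed

theorem theorem8:
  fixes n k r :: nat
  assumes "r > 0" and "n dvd 2 * r" and "k dvd r"
  shows "elem_relations n k r =
           cfun.span (on_elems n k r ` (trivial_relations n k r \<union> exchange_relations n k r)) \<and>
         indexed_relations n k r =
           cfun.span (on_nonzero n k r `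
             (trivial_relations n k r \<union> reorderings r \<union> exchange_relations n k r))"
proof -
  have "n > 0" "k > 0" using assms by (auto intro: Nat.gr0I)
  then show ?thesis
    by (intro conjI elem_relations_eq_span indexed_relations_eq_span assms(2,3))
qed

end
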